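(* For every sufficiently small constant $\epsilon>0$, testing with two-sided error whether a finite set $X\subseteq\mathbb{R}^n$ with labels $\ell:X\to\{\pm1\}$ is realizable by a halfspace, or whether at least $\epsilon|X|$ labels must be changed for it to become realizable by a halfspace, requires at least $n^{1-o(1)}$ samples, where $o(1)\to0$ as $n\to\infty$.
   Context: A halfspace is a function $h:\mathbb{R}^n\to\{\pm1\}$ of the form $h(x)=\mathrm{sign}(w_0+\sum_{i=1}^n w_ix_i)$ with $w_0,\dots,w_n\in\mathbb{R}$; $(X,\ell)$ is realizable by a halfspace if some halfspace $h$ satisfies $h(x)=\ell(x)$ for all $x\in X$. The testing model: an algorithm (randomized, computationally unbounded) using $m$ samples receives $m$ independent labelled points $(x,\ell(x))$ with $x$ drawn uniformly at random from the unknown set $X$. For every $(X,\ell)$ it must output $1$ with probability at least $2/3$ if $(X,\ell)$ is realizable by a halfspace, and output $0$ with probability at least $2/3$ if at least $\epsilon|X|$ of the labels must be changed in order for the labelled set to become realizable by a halfspace. *)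

theory Defs
  imports "HOL-Probability.Probability"
begin

text \<open>
  The dimension has to vary inside a single statement, so \<open>\<real>\<^sup>n\<close> is the set of real functions
  on \<open>{1..n}\<close>, made extensional so that distinct elements differ in some coordinate \<open>1, \<dots>, n\<close>.
\<close>

type_synonym point = "nat \<Rightarrow> real"

type_synonym labelling = "point \<Rightarrow> int"

definition euclid :: "nat \<Rightarrow> point set" where
  "euclid n = {1..n} \<rightarrow>\<^sub>E (UNIV :: real set)"

text \<open>
  The library's \<^const>\<open>sgn\<close> vanishes at \<open>0\<close>; a \<open>\<plusminus>1\<close>-valued sign has to fix a value there. For
  finite point sets the choice does not affect which labellings are realizable.
\<close>

definition pm_sign :: "real \<Rightarrow> int" where
  "pm_sign t = (if t \<ge> 0 then 1 else - 1)"

definition halfspace :: "nat \<Rightarrow> (point \<Rightarrow> int) \<Rightarrow> bool" where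
  "halfspace n h \<longleftrightarrow>
     (\<exists>w :: nat \<Rightarrow> real. \<forall>x \<in> euclid n. h x = pm_sign (w 0 + (\<Sum>i = 1..n. w i * x i)))"

definition labelled_set :: "nat \<Rightarrow> point set \<Rightarrow> labelling \<Rightarrow> bool" where
  "labelled_set n X l \<longleftrightarrow>
     finite X \<and> X \<noteq> {} \<and> X \<subseteq> euclid n \<and> (\<forall>x \<in> X. l x \<in> {1, - 1})"

definition realizable :: "nat \<Rightarrow> point set \<Rightarrow> labelling \<Rightarrow> bool" where
  "realizable n X l \<longleftrightarrow> (\<exists>h. halfspace n h \<and> (\<forall>x \<in> X. h x = l x))"

definition far_from_realizable :: "nat \<Rightarrow> real \<Rightarrow> point set \<Rightarrow> labelling \<Rightarrow> bool" where
  "far_from_realizable n \<epsilon> X l \<longleftrightarrow>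
     (\<forall>l'. labelled_set n X l' \<and> realizable n X l' \<longrightarrow>
        real (card {x \<in> X. l' x \<noteq> l x}) \<ge> \<epsilon> * real (card X))"

definition labelled_samples :: "nat \<Rightarrow> point set \<Rightarrow> labelling \<Rightarrow> (point \<times> int) list pmf" where
  "labelled_samples m X l = replicate_pmf m (map_pmf (\<lambda>x. (x, l x)) (pmf_of_set X))"

text \<open>
  A randomized, computationally unbounded algorithm maps the list of received samples to a
  distribution on its output bit, with \<^const>\<open>True\<close> for output \<open>1\<close> and \<^const>\<open>False\<close> for
  output \<open>0\<close>. It may depend on \<open>n\<close>, \<open>\<epsilon>\<close> and \<open>m\<close>, but not on \<open>X\<close> or \<open>l\<close>.
\<close>

type_synonym algorithm = "(point \<times> int) list \<Rightarrow> bool pmf"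

definition tester_output :: "algorithm \<Rightarrow> nat \<Rightarrow> point set \<Rightarrow> labelling \<Rightarrow> bool pmf" where
  "tester_output A m X l = bind_pmf (labelled_samples m X l) A"

definition halfspace_tester :: "nat \<Rightarrow> real \<Rightarrow> nat \<Rightarrow> algorithm \<Rightarrow> bool" where
  "halfspace_tester n \<epsilon> m A \<longleftrightarrow>
     (\<forall>X l. labelled_set n X l \<longrightarrow>
        (realizable n X l \<longrightarrow> pmf (tester_output A m X l) True \<ge> 2 / 3) \<and>
        (far_from_realizable n \<epsilon> X l \<longrightarrow> pmf (tester_output A m X l) False \<ge> 2 / 3))"

end

theory Submission
  imports Defs "HOL-Computational_Algebra.Polynomial"
begin

text \<open>
  All points lie on the moment curve \<open>t \<mapsto> (t, t\<^sup>2, \<dots>, t\<^sup>n)\<close> with integral \<open>t\<close>, where halfspaces are the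
  signs of polynomials of degree at most \<open>n\<close>. The integers are cut into stripes of length \<open>2W\<close>;
  a point is labelled \<open>+\<close> in the first half of its stripe and \<open>-\<close> in the second, so that labels
  carry no information beyond the points. A set meeting at most \<open>n/2\<close> stripes is realizable,
  whereas each stripe met in both halves contributes a root unless one of its labels is changed.
  Hence it suffices to show that few and many occupied stripes are hard to tell apart.

  The instance consists of \<open>N\<close> independent blocks, proportional in number to \<open>n\<close>. In each block
  \<open>W\<close> pairs of points are thrown into stripes by a random map that takes \<open>u\<close> uniformly random
  values. The law of any \<open>k\<close> coordinates of that map is a polynomial of degree at most \<open>k\<close> in
  \<open>1/u\<close>, whose value at \<open>0\<close> belongs to independent uniform stripes. Richardson extrapolation from
  the nodes \<open>64\<^sup>-\<^sup>j\<close>, \<open>j \<le> K\<close>, to \<open>0\<close> has coefficients of total variation at most \<open>9/8\<close>.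
  Separating the signs yields two mixtures over \<open>u\<close> that agree on any \<open>K\<close> coordinates; one of them uses
  only \<open>u \<le> 64\<^sup>K\<close>, the other is mostly the independent law. A tester must therefore see some
  block more than \<open>K\<close> times, which happens with probability at most \<open>N (m/N)\<^sup>K\<^sup>+\<^sup>1\<close>, and so \<open>m\<close> is at
  least of order \<open>n\<^bsup>K/(K+1)\<^esup>\<close> for every \<open>K\<close>.
\<close>

section \<open>Matching moments\<close>

lemma extrapolation_weights:
  "\<exists>c :: nat \<Rightarrow> real.
     (\<forall>i\<le>K. (\<Sum>j\<le>K. c j * ((1 / 64) ^ j) ^ i) = (if i = 0 then 1 else 0)) \<and>
     (\<Sum>j\<le>K. \<bar>c j\<bar>) \<le> 9 / 8 - 1 / 8 * (1 / 2) ^ K"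
proof (induction K) \<comment> \<open>one Richardson step cancels one further power\<close>
  case 0
  show ?case by (rule exI[of _ "\<lambda>_. 1"]) auto
next
  case (Suc K)
  then obtain c :: "nat \<Rightarrow> real" where
    c: "\<And>i. i \<le> K \<Longrightarrow> (\<Sum>j\<le>K. c j * ((1 / 64) ^ j) ^ i) = (if i = 0 then 1 else 0)" and
    abs_c: "(\<Sum>j\<le>K. \<bar>c j\<bar>) \<le> 9 / 8 - 1 / 8 * (1 / 2) ^ K"
    by blast
  define a :: real where "a = 64 ^ Suc K"
  have a_ge: "a \<ge> 32 * 2 ^ Suc K"
  proof -
    have "(32::real) ^ Suc K * 2 ^ Suc K = a"
      unfolding a_def by (simp flip: power_mult_distrib)
    moreover have "(32::real) \<le> 32 ^ Suc K" by simp
    ultimately show ?thesis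
      by (metis mult_right_mono zero_le_numeral zero_le_power)
  qed
  have two: "(2::real) ^ Suc K \<ge> 2" by (simp add: self_le_power)
  have a1: "a > 1" using a_ge two by linarith
  \<comment> \<open>Richardson step: the old weights moved one node further and scaled by
    \<open>a\<close>, minus the old weights. On i-th powers this multiplies the old sum by (a/64^i -
    1)/(a - 1), which is 1 for i = 0 and 0 for i = K + 1.\<close>
  define d where "d j = (a * (if j = 0 then 0 else c (j - 1)) - (if j \<le> K then c j else 0)) / (a - 1)" for j
  have split: "(\<Sum>j\<le>Suc K. d j * g j) = (a * (\<Sum>j\<le>K. c j * g (Suc j)) - (\<Sum>j\<le>K. c j * g j)) / (a - 1)" for g
  proof -
    have "(\<Sum>j\<le>Suc K. d j * g j) =
        (a * (\<Sum>j\<le>Suc K. (if j = 0 then 0 else c (j - 1)) * g j)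
          - (\<Sum>j\<le>Suc K. (if j \<le> K then c j else 0) * g j)) / (a - 1)"
      by (simp only: d_def sum_distrib_left sum_subtractf[symmetric] sum_divide_distrib)
         (rule sum.cong, auto simp: field_simps diff_divide_distrib)
    also have "(\<Sum>j\<le>Suc K. (if j = 0 then 0 else c (j - 1)) * g j) = (\<Sum>j\<le>K. c j * g (Suc j))"
      by (subst sum.atMost_Suc_shift) simp
    also have "(\<Sum>j\<le>Suc K. (if j \<le> K then c j else 0) * g j) = (\<Sum>j\<le>K. c j * g j)"
      by simp
    finally show ?thesis .
  qed
  have "(\<Sum>j\<le>Suc K. d j * ((1 / 64) ^ j) ^ i) = (if i = 0 then 1 else 0)" if "i \<le> Suc K" for i
  proof -
    have "(\<Sum>j\<le>Suc K. d j * ((1 / 64) ^ j) ^ i) =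
        (a * (1 / 64) ^ i - 1) / (a - 1) * (\<Sum>j\<le>K. c j * ((1 / 64) ^ j) ^ i)"
    proof -
      have "(\<Sum>j\<le>K. c j * ((1 / 64) ^ Suc j) ^ i) = (1 / 64) ^ i * (\<Sum>j\<le>K. c j * ((1 / 64) ^ j) ^ i)"
        by (simp only: sum_distrib_left power_Suc power_mult_distrib mult.left_commute)
      then show ?thesis by (subst split) (simp add: left_diff_distrib)
    qed
    moreover have "a * (1 / 64) ^ i = 1" if "i = Suc K"
      unfolding that a_def by (simp flip: power_mult_distrib)
    ultimately show ?thesis
      using c[of i] that a1 by (cases "i = Suc K") auto
  qed
  \<comment> \<open>The absolute sum grows by a factor of at most (a + 1)/(a - 1) = 1 + 2/(a - 1).
    The term subtracted from 9/8 halves at each step, and the room thus gained absorbs the growth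
    because a >= 32 t for t = 2^(K+1).\<close>
  moreover have "(\<Sum>j\<le>Suc K. \<bar>d j\<bar>) \<le> 9 / 8 - 1 / 8 * (1 / 2) ^ Suc K"
  proof -
    have "\<bar>d j\<bar> \<le> (a * (if j = 0 then 0 else \<bar>c (j - 1)\<bar>) + (if j \<le> K then \<bar>c j\<bar> else 0)) / (a - 1)" for j
      using a1 by (auto simp: d_def abs_mult intro!: divide_right_mono abs_triangle_ineq4[THEN order_trans])
    then have "(\<Sum>j\<le>Suc K. \<bar>d j\<bar>) \<le>
        (\<Sum>j\<le>Suc K. (a * (if j = 0 then 0 else \<bar>c (j - 1)\<bar>) + (if j \<le> K then \<bar>c j\<bar> else 0)) / (a - 1))"
      by (rule sum_mono)
    also have "\<dots> = (a * (\<Sum>j\<le>Suc K. if j = 0 then 0 else \<bar>c (j - 1)\<bar>)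
          + (\<Sum>j\<le>Suc K. if j \<le> K then \<bar>c j\<bar> else 0)) / (a - 1)"
      by (simp only: sum_distrib_left sum.distrib[symmetric] sum_divide_distrib)
    also have "(\<Sum>j\<le>Suc K. if j = 0 then 0 else \<bar>c (j - 1)\<bar>) = (\<Sum>j\<le>K. \<bar>c j\<bar>)"
      by (subst sum.atMost_Suc_shift) simp
    also have "(\<Sum>j\<le>Suc K. if j \<le> K then \<bar>c j\<bar> else 0) = (\<Sum>j\<le>K. \<bar>c j\<bar>)"
      by simp
    finally have 1: "(\<Sum>j\<le>Suc K. \<bar>d j\<bar>) \<le> (\<Sum>j\<le>K. \<bar>c j\<bar>) * ((a + 1) / (a - 1))"
      by (simp add: algebra_simps add_divide_distrib)
    define s where "s = (\<Sum>j\<le>K. \<bar>c j\<bar>)"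
    define t :: real where "t = 2 ^ Suc K"
    have s: "s \<le> 9 / 8 - 1 / 4 / t" "t \<ge> 2" "a \<ge> 32 * t"
      using abs_c two a_ge by (auto simp: s_def t_def power_divide)
    have "1 / 4 / t > 0" using s by auto
    then have s9: "s \<le> 9 / 8" using s by linarith
    have "(a - 1) \<ge> 18 * t" using s by linarith
    then have "9 / 4 / (a - 1) \<le> 9 / 4 / (18 * t)"
      using s by (intro divide_left_mono) auto
    then have inv: "2 * (9 / 8) / (a - 1) \<le> 1 / 8 / t" by simp
    have "s * ((a + 1) / (a - 1)) = s + 2 * s / (a - 1)" using a1 by (simp add: field_simps)
    also have "2 * s / (a - 1) \<le> 2 * (9 / 8) / (a - 1)" using s9 a1 by (intro divide_right_mono) auto
    also have "s + 2 * (9 / 8) / (a - 1) \<le> 9 / 8 - 1 / 4 / t + 1 / 8 / t"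
      using s inv by linarith
    also have "\<dots> = 9 / 8 - 1 / 8 * (1 / 2) ^ Suc K" by (simp add: t_def power_divide)
    finally show ?thesis using 1 unfolding s_def by simp
  qed
  ultimately show ?case by blast
qed

section \<open>Expectations over finitely supported product laws\<close>

lemma expectation_bind_finite:
  fixes h :: "'b \<Rightarrow> real"
  assumes "finite (set_pmf p)" "\<And>x. x \<in> set_pmf p \<Longrightarrow> finite (set_pmf (f x))"
  shows "measure_pmf.expectation (bind_pmf p f) h =
    measure_pmf.expectation p (\<lambda>x. measure_pmf.expectation (f x) h)"
  by (subst pmf_expectation_bind[of "set_pmf p"], use assms in auto)
     (subst integral_measure_pmf[of "set_pmf p"], use assms in auto)

lemma finite_set_Pi_pmf:
  "finite A \<Longrightarrow> (\<And>x. x \<in> A \<Longrightarrow> finite (set_pmf (p x))) \<Longrightarrow> finite (set_pmf (Pi_pmf A d p))"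
  by (simp add: set_Pi_pmf finite_PiE_dflt)

lemma expectation_Pi_pmf_insert:
  fixes h :: "('a \<Rightarrow> 'b) \<Rightarrow> real"
  assumes "finite A" "x \<notin> A" "\<And>y. finite (set_pmf (p y))"
  shows "measure_pmf.expectation (Pi_pmf (insert x A) d p) h =
    measure_pmf.expectation (p x) (\<lambda>a. measure_pmf.expectation (Pi_pmf A d p) (\<lambda>f. h (f(x := a))))"
  unfolding Pi_pmf_insert'[OF assms(1,2)] using assms
  by (simp add: expectation_bind_finite finite_set_Pi_pmf)

lemma expectation_Pi_pmf_component_eq:
  fixes F :: "('a \<Rightarrow> 'b) \<Rightarrow> real"
  assumes "finite A" "x \<in> A" "\<And>y. finite (set_pmf (p y))"
  shows "measure_pmf.expectation (Pi_pmf A d p) (\<lambda>f. of_bool (f x = a) * F f) =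
    pmf (p x) a * measure_pmf.expectation (Pi_pmf (A - {x}) d p) (\<lambda>f. F (f(x := a)))"
proof -
  have A: "A = insert x (A - {x})" using assms by blast
  show ?thesis
    by (subst A, subst expectation_Pi_pmf_insert, use assms in auto)
       (subst integral_measure_pmf[of "{a}"], auto)
qed

text \<open>
  The induction reveals one factor at a time; the offsets \<^term>\<open>c\<close> and \<^term>\<open>r\<close> count the
  coordinates of \<^term>\<open>L\<close> that have already been revealed.
\<close>

lemma count_moment_polynomial:
  fixes p :: "'b pmf" and h :: "'a \<Rightarrow> 'b"
  assumes p: "finite (set_pmf p)" and "finite S"
  shows "\<exists>q :: real poly. degree q \<le> card S \<and> poly q 0 = (\<Prod>v\<in>S. pmf p (h v)) \<and>
    (\<forall>I :: nat set. finite I \<and> card I + r > 0 \<longrightarrow>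
       measure_pmf.expectation (Pi_pmf I d (\<lambda>_. p))
         (\<lambda>L. \<Prod>v\<in>S. (c (h v) + real (card {i \<in> I. L i = h v})) / real (card I + r))
       = poly q (1 / real (card I + r)))"
  using \<open>finite S\<close>
proof (induction S arbitrary: c r rule: finite_induct)
  case empty
  show ?case by (rule exI[of _ 1]) simp
next
  case (insert v S)
  define x where "x = h v"
  define c' where "c' = c(x := c x + 1)"
  obtain q0 where q0: "degree q0 \<le> card S" "poly q0 0 = (\<Prod>v\<in>S. pmf p (h v))"
    "\<And>I :: nat set. finite I \<Longrightarrow> card I + r > 0 \<Longrightarrow>
       measure_pmf.expectation (Pi_pmf I d (\<lambda>_. p))
         (\<lambda>L. \<Prod>v\<in>S. (c (h v) + real (card {i \<in> I. L i = h v})) / real (card I + r))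
       = poly q0 (1 / real (card I + r))"
    using insert.IH[of r c] by blast
  \<comment> \<open>Fixing \<open>L i = x\<close> removes \<open>i\<close> from \<open>I\<close>;
    raising \<open>r\<close> by one keeps the denominator the same, and \<open>c'\<close> credits
    the revealed hit.\<close>
  obtain q1 where q1: "degree q1 \<le> card S" "poly q1 0 = (\<Prod>v\<in>S. pmf p (h v))"
    "\<And>I :: nat set. finite I \<Longrightarrow> card I + Suc r > 0 \<Longrightarrow>
       measure_pmf.expectation (Pi_pmf I d (\<lambda>_. p))
         (\<lambda>L. \<Prod>v\<in>S. (c' (h v) + real (card {i \<in> I. L i = h v})) / real (card I + Suc r))
       = poly q1 (1 / real (card I + Suc r))"
    using insert.IH[of "Suc r" c'] by blast
  \<comment> \<open>Write X = 1/u and expand the factor of \<open>v\<close>: the offset contributes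
    c(x) X q0, and the |I| = u - r equal terms of weight p(x)/u contribute p(x) (1 - r X)
    q1.\<close>
  define q where "q = [:0, c x:] * q0 + [:pmf p x, - (pmf p x * real r):] * q1"
  have "degree ([:0, c x:] * q0) \<le> Suc (card S)" "degree ([:pmf p x, - (pmf p x * real r):] * q1) \<le> Suc (card S)"
    using q0(1) q1(1) degree_mult_le[of "[:0, c x:]" q0] degree_pCons_le[of 0 "[:c x:]"]
      degree_mult_le[of "[:pmf p x, - (pmf p x * real r):]" q1]
      degree_pCons_le[of "pmf p x" "[:- (pmf p x * real r):]"] degree_pCons_0[of "c x"]
      degree_pCons_0[of "- (pmf p x * real r)"]
    by linarith+
  then have "degree q \<le> Suc (card S)"
    unfolding q_def by (rule degree_add_le)
  then have deg: "degree q \<le> card (insert v S)" using insert by simp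
  have at0: "poly q 0 = (\<Prod>v\<in>insert v S. pmf p (h v))"
    using insert by (simp add: q_def q1(2) x_def)
  have "measure_pmf.expectation (Pi_pmf I d (\<lambda>_. p))
         (\<lambda>L. \<Prod>v\<in>insert v S. (c (h v) + real (card {i \<in> I. L i = h v})) / real (card I + r))
       = poly q (1 / real (card I + r))" if I: "finite I" "card I + r > 0" for I :: "nat set"
  proof -
    define u where "u = real (card I + r)"
    have u: "u > 0" using I(2) unfolding u_def by (rule of_nat_0_less_iff[THEN iffD2])
    define F where "F L = (\<Prod>v\<in>S. (c (h v) + real (card {i \<in> I. L i = h v})) / u)" for L
    note int = integrable_measure_pmf_finite[OF finite_set_Pi_pmf[OF I(1), of "\<lambda>_. p", OF p], of d]
    have "measure_pmf.expectation (Pi_pmf I d (\<lambda>_. p))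
         (\<lambda>L. \<Prod>v\<in>insert v S. (c (h v) + real (card {i \<in> I. L i = h v})) / u)
       = measure_pmf.expectation (Pi_pmf I d (\<lambda>_. p))
         (\<lambda>L. c x / u * F L + (\<Sum>i\<in>I. 1 / u * (of_bool (L i = x) * F L)))"
    proof (rule Bochner_Integration.integral_cong[OF refl])
      fix L :: "nat \<Rightarrow> 'b"
      have "real (card {i \<in> I. L i = x}) = (\<Sum>i\<in>I. of_bool (L i = x))"
        using I(1) by (simp add: Collect_conj_eq)
      then show "(\<Prod>v\<in>insert v S. (c (h v) + real (card {i \<in> I. L i = h v})) / u) =
          c x / u * F L + (\<Sum>i\<in>I. 1 / u * (of_bool (L i = x) * F L))"
        using insert(1,2) unfolding sum_distrib_left[symmetric] sum_distrib_right[symmetric]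
        by (simp add: F_def x_def add_divide_distrib distrib_right del: sum_of_bool_eq)
    qed
    also have "\<dots> = c x / u * measure_pmf.expectation (Pi_pmf I d (\<lambda>_. p)) F +
        (\<Sum>i\<in>I. 1 / u * measure_pmf.expectation (Pi_pmf I d (\<lambda>_. p)) (\<lambda>L. of_bool (L i = x) * F L))"
      by (simp only: Bochner_Integration.integral_add[OF int int] Bochner_Integration.integral_sum[OF int]
          integral_mult_right_zero)
    also have "measure_pmf.expectation (Pi_pmf I d (\<lambda>_. p)) F = poly q0 (1 / u)"
      unfolding F_def u_def by (rule q0(3)[OF I])
    also have "(\<Sum>i\<in>I. 1 / u * measure_pmf.expectation (Pi_pmf I d (\<lambda>_. p)) (\<lambda>L. of_bool (L i = x) * F L))
      = (\<Sum>i\<in>I. 1 / u * (pmf p x * poly q1 (1 / u)))"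
    proof (rule sum.cong[OF refl])
      fix i assume i: "i \<in> I"
      have u': "u = real (card (I - {i}) + Suc r)"
        unfolding u_def using card_Suc_Diff1[OF I(1) i] by linarith
      have "F (L(i := x)) = (\<Prod>v\<in>S. (c' (h v) + real (card {j \<in> I - {i}. L j = h v})) / u)" for L
        unfolding F_def
      proof (rule prod.cong[OF refl])
        fix w
        have "{j \<in> I. (L(i := x)) j = h w} =
            (if h w = x then insert i {j \<in> I - {i}. L j = h w} else {j \<in> I - {i}. L j = h w})"
          using i by auto
        then have "real (card {j \<in> I. (L(i := x)) j = h w}) =
            of_bool (h w = x) + real (card {j \<in> I - {i}. L j = h w})"
          using I(1) by simp
        then show "(c (h w) + real (card {j \<in> I. (L(i := x)) j = h w})) / u =
            (c' (h w) + real (card {j \<in> I - {i}. L j = h w})) / u"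
          by (simp add: c'_def)
      qed
      then have "measure_pmf.expectation (Pi_pmf I d (\<lambda>_. p)) (\<lambda>L. of_bool (L i = x) * F L) =
          pmf p x * poly q1 (1 / u)"
        using q1(3)[of "I - {i}"] I(1) i p
        by (subst expectation_Pi_pmf_component_eq) (simp_all add: u')
      then show "1 / u * measure_pmf.expectation (Pi_pmf I d (\<lambda>_. p)) (\<lambda>L. of_bool (L i = x) * F L) =
          1 / u * (pmf p x * poly q1 (1 / u))" by simp
    qed
    also have "\<dots> = (u - real r) / u * (pmf p x * poly q1 (1 / u))"
      by (simp add: u_def)
    also have "c x / u * poly q0 (1 / u) + (u - real r) / u * (pmf p x * poly q1 (1 / u)) = poly q (1 / u)"
      using u by (simp add: q_def field_simps)
    finally show ?thesis unfolding u_def .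
  qed
  with deg at0 show ?case by (intro exI[of _ q] conjI allI impI) simp_all
qed

section \<open>Two mixing laws with equal moments\<close>

lemma ex_pmf_finite_support:
  fixes f :: "'a \<Rightarrow> real"
  assumes "finite A" "\<And>x. x \<in> A \<Longrightarrow> f x \<ge> 0" "sum f A = 1"
  shows "\<exists>p. set_pmf p \<subseteq> A \<and> (\<forall>x\<in>A. pmf p x = f x)"
proof -
  define g where "g x = (if x \<in> A then f x else 0)" for x
  have nonneg: "g x \<ge> 0" for x using assms(2) by (simp add: g_def)
  have "(\<integral>\<^sup>+x. ennreal (g x) \<partial>count_space UNIV) = (\<Sum>x\<in>A. ennreal (g x))"
    using assms(1) by (intro nn_integral_count_space') (auto simp: g_def)
  also have "\<dots> = 1"
    using assms nonneg by (simp add: sum_ennreal g_def)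
  finally have "pmf (embed_pmf g) x = g x" "set_pmf (embed_pmf g) = {x. g x \<noteq> 0}" for x
    using nonneg by (simp_all add: pmf_embed_pmf set_embed_pmf)
  then show ?thesis
    by (intro exI[of _ "embed_pmf g"]) (auto simp: g_def split: if_splits)
qed

text \<open>The signs of the extrapolation weights are separated: the positive parts form
  \<open>p\<close>; the target value at 0 together with the negative parts forms \<open>p'\<close>.
  Both sides have total mass Z = (1 + sum of |c_j|)/2 <= 17/16, so after normalization the atom at 0
  weighs at least 16/17.\<close>

lemma moment_matching_pair:
  "\<exists>p p' :: nat pmf. set_pmf p \<subseteq> {1..64 ^ K} \<and> finite (set_pmf p') \<and> pmf p' 0 \<ge> 15 / 16 \<and>
    (\<forall>q :: real poly. degree q \<le> K \<longrightarrow>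
       measure_pmf.expectation p (\<lambda>u. poly q (1 / real u)) =
       measure_pmf.expectation p' (\<lambda>u. poly q (1 / real u)))"
proof -
  obtain c :: "nat \<Rightarrow> real" where
    c: "\<And>i. i \<le> K \<Longrightarrow> (\<Sum>j\<le>K. c j * ((1 / 64) ^ j) ^ i) = (if i = 0 then 1 else 0)" and
    abs_c: "(\<Sum>j\<le>K. \<bar>c j\<bar>) \<le> 9 / 8 - 1 / 8 * (1 / 2) ^ K"
    using extrapolation_weights[of K] by blast
  have sum_c: "(\<Sum>j\<le>K. c j) = 1" using c[of 0] by simp
  have "(1 / 8 * (1 / 2) ^ K :: real) \<ge> 0" by simp
  with abs_c have abs_c': "(\<Sum>j\<le>K. \<bar>c j\<bar>) \<le> 9 / 8" by linarith
  define Z where "Z = (\<Sum>j\<le>K. max (c j) 0)"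
  have neg: "(\<Sum>j\<le>K. max (- c j) 0) = Z - 1"
  proof -
    have "Z - (\<Sum>j\<le>K. max (- c j) 0) = (\<Sum>j\<le>K. c j)"
      unfolding Z_def sum_subtractf[symmetric] by (rule sum.cong) auto
    then show ?thesis using sum_c by simp
  qed
  have "2 * Z = (\<Sum>j\<le>K. c j + \<bar>c j\<bar>)"
    unfolding Z_def sum_distrib_left by (rule sum.cong) auto
  then have Z_le: "Z \<le> 17 / 16" using sum_c abs_c' by (simp add: sum.distrib)
  have Z_ge: "Z \<ge> 1" using neg sum_nonneg[of "{..K}" "\<lambda>j. max (- c j) 0"] by simp
  have "(\<Sum>j\<le>K. max (c j) 0 / Z) = 1"
    using Z_ge by (simp add: Z_def flip: sum_divide_distrib)
  then obtain p where p: "set_pmf p \<subseteq> {..K}" "\<And>j. j \<le> K \<Longrightarrow> pmf p j = max (c j) 0 / Z"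
    using ex_pmf_finite_support[of "{..K}" "\<lambda>j. max (c j) 0 / Z"] Z_ge by auto
  define w where "w j = (case j of 0 \<Rightarrow> 1 / Z | Suc j \<Rightarrow> max (- c j) 0 / Z)" for j
  have "sum w {..Suc K} = 1"
    unfolding sum.atMost_Suc_shift using Z_ge neg
    by (simp add: w_def flip: sum_divide_distrib add_divide_distrib)
  moreover have "w j \<ge> 0" for j using Z_ge by (simp add: w_def split: nat.split)
  ultimately obtain p' where p': "set_pmf p' \<subseteq> {..Suc K}" "\<And>j. j \<le> Suc K \<Longrightarrow> pmf p' j = w j"
    using ex_pmf_finite_support[of "{..Suc K}" w] by auto
  \<comment> \<open>Index 0 is the extra atom. It is sent to u = 0, where 1/u is 0 by convention, so
    that it evaluates \<open>q\<close> at 0.\<close>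
  define node :: "nat \<Rightarrow> nat" where "node j = (case j of 0 \<Rightarrow> 0 | Suc j \<Rightarrow> 64 ^ j)" for j
  have eq: "measure_pmf.expectation (map_pmf (\<lambda>j. 64 ^ j) p) (\<lambda>u. poly q (1 / real u)) =
       measure_pmf.expectation (map_pmf node p') (\<lambda>u. poly q (1 / real u))"
    if q: "degree q \<le> K" for q
  proof -
    let ?x = "\<lambda>j. (1 / 64 :: real) ^ j"
    have "(\<Sum>j\<le>K. c j * poly q (?x j)) = (\<Sum>j\<le>K. \<Sum>i\<le>degree q. coeff q i * (c j * ?x j ^ i))"
      by (simp add: poly_altdef sum_distrib_left mult_ac)
    also have "\<dots> = (\<Sum>i\<le>degree q. coeff q i * (\<Sum>j\<le>K. c j * ?x j ^ i))"
      by (subst sum.swap) (simp add: sum_distrib_left)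
    also have "\<dots> = (\<Sum>i\<le>degree q. if i = 0 then coeff q 0 else 0)"
      using q by (intro sum.cong) (auto simp: c)
    also have "\<dots> = poly q 0" by (simp add: poly_0_coeff_0)
    finally have key: "(\<Sum>j\<le>K. c j * poly q (?x j)) = poly q 0" .
    have "measure_pmf.expectation (map_pmf (\<lambda>j. 64 ^ j) p) (\<lambda>u. poly q (1 / real u)) =
        (\<Sum>j\<le>K. max (c j) 0 / Z * poly q (?x j))"
      using p by (simp, subst integral_measure_pmf[of "{..K}"]) (auto simp: power_divide)
    also have "\<dots> = (\<Sum>j\<le>K. c j * poly q (?x j) / Z + max (- c j) 0 / Z * poly q (?x j))"
      by (rule sum.cong) (auto simp: max_def)
    also have "\<dots> = poly q 0 / Z + (\<Sum>j\<le>K. max (- c j) 0 / Z * poly q (?x j))"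
      by (simp add: sum.distrib key flip: sum_divide_distrib)
    also have "\<dots> = (\<Sum>j\<le>Suc K. w j * poly q (1 / real (node j)))"
      unfolding sum.atMost_Suc_shift by (simp add: w_def node_def power_divide)
    also have "\<dots> = measure_pmf.expectation (map_pmf node p') (\<lambda>u. poly q (1 / real u))"
      using p' by (simp, subst integral_measure_pmf[of "{..Suc K}"]) auto
    finally show ?thesis .
  qed
  have "pmf p' 0 = measure p' {0}" by (simp add: measure_pmf_single)
  also have "\<dots> \<le> measure p' (node -` {0})"
    by (rule measure_pmf.finite_measure_mono) (auto simp: node_def)
  finally have "pmf p' 0 \<le> pmf (map_pmf node p') 0" by (simp add: pmf_map)
  moreover have "15 / 16 \<le> pmf p' 0"
    using Z_le Z_ge by (simp add: p'(2) w_def field_simps)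
  moreover have "set_pmf (map_pmf (\<lambda>j. (64 :: nat) ^ j) p) \<subseteq> {1..64 ^ K}"
    using p(1) by (auto intro: power_increasing)
  moreover have "finite (set_pmf (map_pmf node p'))"
    using finite_subset[OF p'(1)] by simp
  ultimately show ?thesis
    using eq by (intro exI[of _ "map_pmf (\<lambda>j. 64 ^ j) p"] exI[of _ "map_pmf node p'"]) auto
qed

text \<open>
  The junk value \<open>1 / 0 = 0\<close> makes \<open>u = 0\<close> stand for the limit \<open>u \<rightarrow> \<infinity>\<close> of infinitely many random
  values.
\<close>

definition slot_law :: "nat \<Rightarrow> nat set \<Rightarrow> nat \<Rightarrow> (nat \<Rightarrow> nat) pmf" where
  "slot_law Q S u = (if u = 0 then Pi_pmf S 0 (\<lambda>_. pmf_of_set {..<Q})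
     else bind_pmf (Pi_pmf {..<u} 0 (\<lambda>_. pmf_of_set {..<Q}))
       (\<lambda>L. Pi_pmf S 0 (\<lambda>_. map_pmf L (pmf_of_set {..<u}))))"

abbreviation restrict0 :: "'a set \<Rightarrow> ('a \<Rightarrow> nat) \<Rightarrow> 'a \<Rightarrow> nat" where
  "restrict0 S g \<equiv> (\<lambda>v. if v \<in> S then g v else 0)"

section \<open>Marginals of the slot laws\<close>

lemma restrict_slot_law:
  assumes "finite T" "S \<subseteq> T"
  shows "map_pmf (restrict0 S) (slot_law Q T u) = slot_law Q S u"
  by (simp add: slot_law_def map_bind_pmf Pi_pmf_subset[OF assms, symmetric])

text \<open>Given \<open>L\<close>, the coordinates are independent and take a value x with
  probability |L^-1(x)|/u. The point probability is therefore the mean of a product of normalized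
  counts with nothing revealed yet, and the value at 0 is the independent case u = 0.\<close>

lemma pmf_slot_law_polynomial:
  assumes "finite S" "Q > 0"
  shows "\<exists>q :: real poly. degree q \<le> card S \<and> (\<forall>u. pmf (slot_law Q S u) g = poly q (1 / real u))"
proof (cases "\<forall>v. v \<notin> S \<longrightarrow> g v = 0")
  case False
  then have "pmf (Pi_pmf S 0 P) g = 0" for P :: "nat \<Rightarrow> nat pmf"
    using assms by (intro pmf_Pi_outside) auto
  then have "pmf (slot_law Q S u) g = poly 0 (1 / real u)" for u
    by (simp add: slot_law_def pmf_bind)
  then show ?thesis by (intro exI[of _ 0]) simp
next
  case True
  let ?U = "pmf_of_set {..<Q}"
  have fin: "finite (set_pmf ?U)" using assms by (subst set_pmf_of_set) auto
  obtain q where q: "degree q \<le> card S" "poly q 0 = (\<Prod>v\<in>S. pmf ?U (g v))"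
    "\<And>I :: nat set. finite I \<Longrightarrow> card I > 0 \<Longrightarrow>
       measure_pmf.expectation (Pi_pmf I 0 (\<lambda>_. ?U))
         (\<lambda>L. \<Prod>v\<in>S. real (card {i \<in> I. L i = g v}) / real (card I)) = poly q (1 / real (card I))"
    using count_moment_polynomial[OF fin assms(1), of g 0 0 "\<lambda>_. 0"] by auto
  have "pmf (slot_law Q S u) g = poly q (1 / real u)" for u
  proof (cases "u = 0")
    case True
    then show ?thesis
      using assms \<open>\<forall>v. v \<notin> S \<longrightarrow> g v = 0\<close> by (simp add: slot_law_def q(2) pmf_Pi')
  next
    case False
    have "pmf (map_pmf L (pmf_of_set {..<u})) x = real (card {i \<in> {..<u}. L i = x}) / real u"
      for L :: "nat \<Rightarrow> nat" and x
    proof -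
      have "{..<u} \<inter> L -` {x} = {i \<in> {..<u}. L i = x}" by auto
      then show ?thesis using False by (simp add: pmf_map measure_pmf_of_set lessThan_empty_iff)
    qed
    then show ?thesis
      using False assms \<open>\<forall>v. v \<notin> S \<longrightarrow> g v = 0\<close> q(3)[of "{..<u}"]
      by (simp add: slot_law_def pmf_bind pmf_Pi')
  qed
  then show ?thesis using q(1) by blast
qed

text \<open>Point probabilities on at most K coordinates are polynomials of degree at most K in 1/u,
  to which moment matching applies. The pair is fixed before \<open>Q\<close> and \<open>S\<close>,
  since one pair has to serve whatever coordinates get sampled.\<close>

lemma indistinguishable_slot_laws:
  "\<exists>p p' :: nat pmf. set_pmf p \<subseteq> {1..64 ^ K} \<and> finite (set_pmf p') \<and> pmf p' 0 \<ge> 15 / 16 \<and>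
    (\<forall>Q S. Q > 0 \<and> finite S \<and> card S \<le> K \<longrightarrow> bind_pmf p (slot_law Q S) = bind_pmf p' (slot_law Q S))"
proof -
  obtain p p' :: "nat pmf" where p: "set_pmf p \<subseteq> {1..64 ^ K}" "finite (set_pmf p')" "pmf p' 0 \<ge> 15 / 16"
    and eq: "\<And>q :: real poly. degree q \<le> K \<Longrightarrow>
       measure_pmf.expectation p (\<lambda>u. poly q (1 / real u)) =
       measure_pmf.expectation p' (\<lambda>u. poly q (1 / real u))"
    using moment_matching_pair[of K] by blast
  have "bind_pmf p (slot_law Q S) = bind_pmf p' (slot_law Q S)"
    if S: "Q > 0" "finite S" "card S \<le> K" for Q S
  proof (rule pmf_eqI)
    fix g
    obtain q where "degree q \<le> card S" "\<And>u. pmf (slot_law Q S u) g = poly q (1 / real u)"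
      using pmf_slot_law_polynomial[OF S(2,1), of g] by blast
    then show "pmf (bind_pmf p (slot_law Q S)) g = pmf (bind_pmf p' (slot_law Q S)) g"
      using eq[of q] S(3) by (simp add: pmf_bind)
  qed
  with p show ?thesis by blast
qed

text \<open>A further coordinate repeats one of the earlier values with probability at most |S|/Q;
  these losses add up to at most |S|^2/Q.\<close>

lemma expected_card_image_Pi_pmf:
  assumes "finite S" "Q > 0"
  shows "measure_pmf.expectation (Pi_pmf S 0 (\<lambda>_. pmf_of_set {..<Q})) (\<lambda>g. real (card (g ` S)))
    \<ge> real (card S) - real (card S) ^ 2 / real Q"
  using assms(1)
proof (induction S rule: finite_induct)
  case empty
  show ?case by simp
next
  case (insert v S)
  let ?U = "pmf_of_set {..<Q}" and ?P = "Pi_pmf S 0 (\<lambda>_. pmf_of_set {..<Q})"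
  have U: "set_pmf ?U = {..<Q}" using assms by (subst set_pmf_of_set) auto
  have fin: "finite (set_pmf ?P)" using insert U by (intro finite_set_Pi_pmf) auto
  have step: "real (card (g ` S)) + (1 - real (card S) / real Q) \<le>
      measure_pmf.expectation ?U (\<lambda>a. real (card (g(v := a) ` insert v S)))" for g
  proof -
    have img: "g(v := a) ` insert v S = insert a (g ` S)" for a
      using insert(2) by auto
    have "real (card (g ` S)) + (1 - of_bool (a \<in> g ` S)) = real (card (insert a (g ` S)))" for a
      using insert(1) by (simp add: card_insert_if)
    then have "measure_pmf.expectation ?U (\<lambda>a. real (card (g(v := a) ` insert v S))) =
        measure_pmf.expectation ?U (\<lambda>a. real (card (g ` S)) + (1 - indicator (g ` S) a))"
      by (simp only: img indicator_def)
    also have "\<dots> = real (card (g ` S)) + (1 - measure ?U (g ` S))"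
      using U by (simp add: integrable_measure_pmf_finite)
    finally have "measure_pmf.expectation ?U (\<lambda>a. real (card (g(v := a) ` insert v S))) =
      real (card (g ` S)) + (1 - measure ?U (g ` S))" .
    moreover have "measure ?U (g ` S) \<le> real (card S) / real Q"
    proof -
      have "card ({..<Q} \<inter> g ` S) \<le> card S"
        using insert(1) by (meson card_image_le card_mono finite_imageI inf_le2 le_trans)
      then show ?thesis using assms by (simp add: measure_pmf_of_set lessThan_empty_iff divide_right_mono)
    qed
    ultimately show ?thesis by linarith
  qed
  have "measure_pmf.expectation (Pi_pmf (insert v S) 0 (\<lambda>_. ?U)) (\<lambda>g. real (card (g ` insert v S)))
    = measure_pmf.expectation ?P (\<lambda>g. measure_pmf.expectation ?U (\<lambda>a. real (card (g(v := a) ` insert v S))))"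
    using insert U fin
    by (subst Pi_pmf_insert', simp, simp, subst bind_commute_pmf) (simp add: expectation_bind_finite)
  also have "\<dots> \<ge> measure_pmf.expectation ?P (\<lambda>g. real (card (g ` S)) + (1 - real (card S) / real Q))"
    using step fin by (intro integral_mono) (auto intro: integrable_measure_pmf_finite)
  also have "measure_pmf.expectation ?P (\<lambda>g. real (card (g ` S)) + (1 - real (card S) / real Q)) =
      measure_pmf.expectation ?P (\<lambda>g. real (card (g ` S))) + (1 - real (card S) / real Q)"
    using fin by (simp add: integrable_measure_pmf_finite)
  finally show ?case
    using insert assms by (auto simp: field_simps power2_eq_square)
qed

section \<open>Halfspaces on the moment curve\<close>

definition curve :: "nat \<Rightarrow> nat \<Rightarrow> point" where
  "curve n t = (\<lambda>i\<in>{1..n}. real t ^ i)"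

text \<open>The first coordinate of a curve point is its parameter, so the label is a function of
  the point alone, the same for all instances with the same \<open>W\<close>.\<close>

definition stripe_label :: "nat \<Rightarrow> labelling" where
  "stripe_label W x = (if nat \<lfloor>x 1\<rfloor> mod (2 * W) < W then 1 else - 1)"

lemma curve_in_euclid: "curve n t \<in> euclid n"
  by (simp add: curve_def euclid_def)

lemma curve_first: "n \<ge> 1 \<Longrightarrow> curve n t 1 = real t"
  by (simp add: curve_def)

lemma inj_curve: "n \<ge> 1 \<Longrightarrow> inj (curve n)"
  by (metis curve_first injI of_nat_eq_iff)

lemma stripe_label_curve:
  "n \<ge> 1 \<Longrightarrow> stripe_label W (curve n t) = (if t mod (2 * W) < W then 1 else - 1)"
  unfolding stripe_label_def by (subst curve_first) simp_all

lemma labelled_set_curve: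
  "finite T \<Longrightarrow> T \<noteq> {} \<Longrightarrow> labelled_set n (curve n ` T) (stripe_label W)"
  by (auto simp: labelled_set_def curve_in_euclid stripe_label_def)

lemma curve_affine_eq_poly:
  assumes "degree q \<le> n"
  shows "coeff q 0 + (\<Sum>i = 1..n. coeff q i * curve n t i) = poly q (real t)"
proof -
  have "poly q (real t) = (\<Sum>i\<le>n. coeff q i * real t ^ i)"
    by (subst (1) poly_as_sum_of_monoms'[OF assms, symmetric]) (simp add: poly_sum poly_monom)
  also have "\<dots> = coeff q 0 + (\<Sum>i = 1..n. coeff q i * real t ^ i)"
    by (simp add: atMost_atLeast0 sum.atLeast_Suc_atMost)
  finally show ?thesis by (simp add: curve_def)
qed

lemma halfspace_of_poly:
  assumes "degree q \<le> n"
  shows "\<exists>h. halfspace n h \<and> (\<forall>t. h (curve n t) = pm_sign (poly q (real t)))"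
  using curve_affine_eq_poly[OF assms]
  by (intro exI[of _ "\<lambda>x. pm_sign (coeff q 0 + (\<Sum>i = 1..n. coeff q i * x i))"])
     (auto simp: halfspace_def)

lemma poly_of_halfspace:
  assumes "halfspace n h"
  shows "\<exists>q. degree q \<le> n \<and> (\<forall>t. h (curve n t) = pm_sign (poly q (real t)))"
proof -
  obtain w :: "nat \<Rightarrow> real" where
    w: "\<And>x. x \<in> euclid n \<Longrightarrow> h x = pm_sign (w 0 + (\<Sum>i = 1..n. w i * x i))"
    using assms by (auto simp: halfspace_def)
  define q where "q = (\<Sum>i\<le>n. monom (w i) i)"
  have deg: "degree q \<le> n"
    unfolding q_def by (intro degree_sum_le) (auto intro: order.trans[OF degree_monom_le])
  have coeff: "coeff q i = w i" if "i \<le> n" for i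
    using that by (simp add: q_def coeff_sum)
  have "w 0 + (\<Sum>i = 1..n. w i * curve n t i) = poly q (real t)" for t
    using curve_affine_eq_poly[OF deg, of t] coeff by simp
  with deg w[OF curve_in_euclid] show ?thesis by (intro exI[of _ q]) simp
qed

text \<open>Two roots for each occupied stripe suffice, one just before its start and one just
  before its middle. At a point of another stripe both factors have the same sign, so stripes do not
  disturb each other.\<close>

lemma realizable_few_stripes:
  assumes "n \<ge> 1" "W > 0" "finite T" "2 * card ((\<lambda>t. t div (2 * W)) ` T) \<le> n"
  shows "realizable n (curve n ` T) (stripe_label W)"
proof -
  define C where "C = (\<lambda>t. t div (2 * W)) ` T"
  \<comment> \<open>The shift by 1/2 keeps the roots away from the integral parameters.\<close>
  define a b :: "nat \<Rightarrow> real" where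
    "a k = 2 * real W * real k - 1 / 2" and "b k = 2 * real W * real k + real W - 1 / 2" for k
  \<comment> \<open>In the first half of a stripe exactly one of its own two factors is negative;
    the minus sign turns this into label +.\<close>
  define q where "q = - (\<Prod>k\<in>C. [:- a k, 1:] * [:- b k, 1:])"
  have "degree (\<Prod>k\<in>C. [:- a k, 1:] * [:- b k, 1:]) \<le> (\<Sum>k\<in>C. degree ([:- a k, 1:] * [:- b k, 1:]))"
    using degree_prod_sum_le[of C "\<lambda>k. [:- a k, 1:] * [:- b k, 1:]"] assms(3) by (simp add: C_def o_def)
  also have "\<dots> \<le> (\<Sum>k\<in>C. 2)"
    by (intro sum_mono order.trans[OF degree_mult_le]) simp
  also have "\<dots> \<le> n" using assms(4) by (simp add: C_def)
  finally have "degree q \<le> n" by (simp add: q_def)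
  then obtain h where h: "halfspace n h" "\<And>t. h (curve n t) = pm_sign (poly q (real t))"
    using halfspace_of_poly by blast
  have "h (curve n t) = stripe_label W (curve n t)" if t: "t \<in> T" for t
  proof -
    define k r where "k = t div (2 * W)" and "r = t mod (2 * W)"
    have r: "r < 2 * W" using assms(2) by (simp add: r_def)
    have "t = 2 * W * k + r" by (simp add: k_def r_def)
    then have t_eq: "real t = 2 * real W * real k + real r" by simp
    have pos: "(real t - a j) * (real t - b j) > 0" if "j \<noteq> k" for j
    proof (cases "j < k")
      case True
      then have "2 * W * (j + 1) \<le> 2 * W * k" by (intro mult_le_mono2) simp
      then have "real (2 * W * (j + 1)) \<le> real (2 * W * k)" by (rule of_nat_mono)
      then show ?thesis by (intro mult_pos_pos) (simp_all add: t_eq a_def b_def algebra_simps)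
    next
      case False
      then have "2 * W * (k + 1) \<le> 2 * W * j" using that by (intro mult_le_mono2) simp
      then have "real (2 * W * (k + 1)) \<le> real (2 * W * j)" by (rule of_nat_mono)
      moreover have "real r + 1 \<le> 2 * real W" using r by linarith
      ultimately show ?thesis
        using assms(2) by (intro mult_neg_neg) (simp_all add: t_eq a_def b_def algebra_simps)
    qed
    have "k \<in> C" using t by (simp add: C_def k_def)
    define P where "P = (\<Prod>j\<in>C - {k}. (real t - a j) * (real t - b j))"
    have P: "P > 0" unfolding P_def by (intro prod_pos) (use pos in auto)
    have "poly q (real t) = - ((real t - a k) * (real t - b k) * P)"
      using \<open>k \<in> C\<close> assms(3) by (simp add: q_def poly_prod P_def prod.remove C_def algebra_simps)
    moreover have "real t - a k > 0" by (simp add: t_eq a_def)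
    moreover have "real t - b k < 0" if "r < W"
      using that by (simp add: t_eq b_def)
    moreover have "real t - b k > 0" if "\<not> r < W"
      using that by (simp add: t_eq b_def)
    ultimately have "pm_sign (poly q (real t)) = (if r < W then 1 else - 1)"
      using P by (cases "r < W") (auto simp: pm_sign_def mult_le_0_iff zero_le_mult_iff)
    then show ?thesis
      using assms(1) by (simp add: h(2) stripe_label_curve r_def)
  qed
  with h(1) show ?thesis by (auto simp: realizable_def)
qed

text \<open>A stripe of \<open>M\<close> without a changed label forces a sign change of the
  polynomial, hence a root inside the stripe, which can happen at most n times. Every other stripe
  of \<open>M\<close> contains a changed point.\<close>

lemma modified_many_stripes:
  assumes "n \<ge> 1" "W > 0" "finite T" "realizable n (curve n ` T) l'"
    and M: "\<And>k. k \<in> M \<Longrightarrow> \<exists>t\<in>T. t div (2 * W) = k \<and> t mod (2 * W) < W"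
      "\<And>k. k \<in> M \<Longrightarrow> \<exists>t\<in>T. t div (2 * W) = k \<and> \<not> t mod (2 * W) < W"
  shows "card M \<le> card {x \<in> curve n ` T. l' x \<noteq> stripe_label W x} + n"
proof -
  obtain q where deg: "degree q \<le> n"
    and q: "\<And>t. t \<in> T \<Longrightarrow> l' (curve n t) = pm_sign (poly q (real t))"
    using assms(4) poly_of_halfspace by (fastforce simp: realizable_def)
  define B where "B = {t \<in> T. l' (curve n t) \<noteq> stripe_label W (curve n t)}"
  define G where "G = M - (\<lambda>t. t div (2 * W)) ` B"
  have root: "\<exists>z. poly q z = 0 \<and> real k \<le> z / (2 * real W) \<and> z / (2 * real W) < real k + 1 \<and> q \<noteq> 0"
    if k: "k \<in> G" for k
  proof -
    have kM: "k \<in> M" and kB: "\<And>t. t \<in> T \<Longrightarrow> t div (2 * W) = k \<Longrightarrow> t \<notin> B"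
      using k by (auto simp: G_def)
    obtain t where t: "t \<in> T" "t div (2 * W) = k" "t mod (2 * W) < W" using M(1)[OF kM] by blast
    obtain t' where t': "t' \<in> T" "t' div (2 * W) = k" "\<not> t' mod (2 * W) < W" using M(2)[OF kM] by blast
    have eqs: "2 * W * k + t mod (2 * W) = t" "2 * W * k + t' mod (2 * W) = t'"
      using mult_div_mod_eq[of "2 * W" t] mult_div_mod_eq[of "2 * W" t'] t(2) t'(2) by simp_all
    have lt: "t < t'" using eqs t(3) t'(3) by linarith
    have lower: "2 * W * k \<le> t" using eqs(1) by linarith
    have upper: "t' < 2 * W * (k + 1)"
      using eqs(2) mod_less_divisor[of "2 * W" t'] assms(2)
      by (simp only: distrib_left mult_1_right) linarith
    \<comment> \<open>\<open>pm_sign\<close> is 1 at 0, so label + yields only a weak inequality;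
      the strict one at \<open>t'\<close> also shows that \<open>q\<close> is not the zero
      polynomial.\<close>
    have "poly q (real t) \<ge> 0" "poly q (real t') < 0"
      using kB[OF t(1,2)] kB[OF t'(1,2)] t t' q[OF t(1)] q[OF t'(1)] assms(1)
      by (auto simp: B_def stripe_label_curve pm_sign_def split: if_splits)
    moreover from this obtain z where "real t \<le> z" "z \<le> real t'" "poly q z = 0"
      using IVT2[of "poly q" "real t'" 0 "real t"] lt by auto
    moreover have "real (2 * W * k) \<le> real t" "real t' < real (2 * W * (k + 1))"
      using lower upper by (simp_all only: of_nat_le_iff of_nat_less_iff)
    ultimately show ?thesis
      using assms(2) by (intro exI[of _ z]) (auto simp: field_simps)
  qed
  have "card G \<le> n"
  proof (cases "G = {}")
    case False
    then have "q \<noteq> 0" using root by blast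
    obtain z where z: "\<And>k. k \<in> G \<Longrightarrow> poly q (z k) = 0"
      "\<And>k. k \<in> G \<Longrightarrow> real k \<le> z k / (2 * real W)" "\<And>k. k \<in> G \<Longrightarrow> z k / (2 * real W) < real k + 1"
      using root by metis
    \<comment> \<open>The rescaled roots lie in disjoint half-open unit intervals, so rounding down
      recovers the stripe and the roots are distinct.\<close>
    have "nat \<lfloor>z k / (2 * real W)\<rfloor> = k" if "k \<in> G" for k
      using z(2,3)[OF that] by (simp add: floor_eq_iff nat_eq_iff floor_unique)
    then have "inj_on z G" by (metis inj_onI)
    then have "card G = card (z ` G)" by (simp add: card_image)
    also have "\<dots> \<le> card {x. poly q x = 0}"
      using z(1) \<open>q \<noteq> 0\<close> by (intro card_mono) (auto simp: poly_roots_finite)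
    also have "\<dots> \<le> degree q" using \<open>q \<noteq> 0\<close> by (rule card_poly_roots_bound)
    finally show ?thesis using deg by simp
  qed simp
  have finB: "finite B" using assms(3) by (simp add: B_def)
  have "finite M"
  proof (rule finite_subset)
    show "M \<subseteq> (\<lambda>t. t div (2 * W)) ` T" using M(1) by blast
  qed (use assms(3) in simp)
  then have "card M \<le> card (G \<union> (\<lambda>t. t div (2 * W)) ` B)"
    using finB by (intro card_mono) (auto simp: G_def)
  also have "\<dots> \<le> card G + card B"
    using card_Un_le card_image_le[OF finB] by (meson add_left_mono le_trans)
  also have "card B = card (curve n ` B)"
    by (rule card_image[symmetric]) (meson inj_curve[OF assms(1)] inj_on_subset subset_UNIV)
  also have "curve n ` B = {x \<in> curve n ` T. l' x \<noteq> stripe_label W x}"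
    by (auto simp: B_def)
  finally show ?thesis using \<open>card G \<le> n\<close> by linarith
qed

section \<open>Random instances made of independent blocks\<close>

lemma map_replicate_pmf:
  "replicate_pmf m (map_pmf f p) = map_pmf (map f) (replicate_pmf m p)"
  by (induction m) (simp_all add: map_bind_pmf bind_map_pmf)

lemma measure_bind_pmf:
  "measure (bind_pmf p f) A = measure_pmf.expectation p (\<lambda>x. measure (f x) A)"
proof -
  have eq: "measure q A = pmf (map_pmf (\<lambda>x. x \<in> A) q) True" for q :: "'a pmf"
    by (simp add: pmf_map vimage_def)
  show ?thesis unfolding eq map_bind_pmf pmf_bind ..
qed

text \<open>Condition on the first sample: with s the probability of \<open>P\<close> and T_m(k) the
  tail, T_{m+1}(k+1) <= T_m(k+1) + s T_m(k). The bound (m s)^k survives this because (m + 1) m^k <=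
  (m + 1)^(k+1).\<close>

lemma replicate_pmf_count_tail:
  "measure (replicate_pmf m p) {xs. k \<le> length (filter P xs)} \<le> (real m * measure p {x. P x}) ^ k"
proof (induction m arbitrary: k)
  case 0
  show ?case by (cases k) auto
next
  case (Suc m)
  show ?case
  proof (cases k)
    case 0
    then show ?thesis by simp
  next
    case (Suc k')
    let ?R = "replicate_pmf m p" and ?s = "measure p {x. P x}"
    define T where "T j = measure ?R {xs. j \<le> length (filter P xs)}" for j
    have "measure (replicate_pmf (Suc m) p) {xs. k \<le> length (filter P xs)} =
        measure_pmf.expectation p (\<lambda>x. measure (map_pmf ((#) x) ?R) {xs. k \<le> length (filter P xs)})"
      by (simp add: measure_bind_pmf map_pmf_def)
    also have "\<dots> = measure_pmf.expectation p (\<lambda>x. T k + indicator {x. P x} x * (T k' - T k))"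
    proof (rule Bochner_Integration.integral_cong[OF refl])
      fix x
      show "measure (map_pmf ((#) x) ?R) {xs. k \<le> length (filter P xs)} =
          T k + indicator {x. P x} x * (T k' - T k)"
        by (cases "P x") (simp_all add: vimage_def T_def Suc)
    qed
    also have "\<dots> = T k + ?s * (T k' - T k)"
    proof -
      have "integrable p (indicator {x. P x} :: _ \<Rightarrow> real)"
        by (rule measure_pmf.integrable_const_bound[where B = 1]) auto
      then show ?thesis by simp
    qed
    also have "\<dots> \<le> T k + ?s * T k'"
      by (simp add: algebra_simps T_def)
    also have "\<dots> \<le> (real m * ?s) ^ k + ?s * (real m * ?s) ^ k'"
      using Suc.IH by (intro add_mono mult_left_mono) (auto simp: T_def)
    also have "\<dots> = ?s ^ k * ((real m + 1) * real m ^ k')"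
      by (simp add: Suc power_mult_distrib algebra_simps)
    also have "\<dots> \<le> ?s ^ k * ((real m + 1) * (real m + 1) ^ k')"
      by (intro mult_left_mono power_mono) auto
    also have "\<dots> = ((real m + 1) * ?s) ^ k"
      unfolding Suc power_mult_distrib power_Suc by (simp only: mult_ac)
    also have "real m + 1 = real (Suc m)" by simp
    finally show ?thesis .
  qed
qed

lemma Pi_pmf_map_dependent:
  assumes "finite A"
  shows "Pi_pmf A d (\<lambda>x. map_pmf (F x) (p x)) =
    map_pmf (\<lambda>f x. if x \<in> A then F x (f x) else d) (Pi_pmf A d' p)"
  unfolding map_pmf_def by (simp add: Pi_pmf_bind[OF assms, of _ _ _ d'] assms)

section \<open>Slots and their points on the curve\<close>

definition slots :: "nat \<Rightarrow> nat \<Rightarrow> (nat \<times> nat \<times> nat) set" where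
  "slots N W = {..<N} \<times> {..<W} \<times> {..<2}"

text \<open>
  Slot \<open>(b, v, s)\<close> is the point with sign bit \<open>s\<close> of the \<open>v\<close>-th pair in block \<open>b\<close>, and \<open>G b v < Q\<close> is
  the stripe of that pair among the \<open>Q\<close> stripes reserved for the block.
\<close>

fun slot_param :: "nat \<Rightarrow> nat \<Rightarrow> (nat \<Rightarrow> nat \<Rightarrow> nat) \<Rightarrow> nat \<times> nat \<times> nat \<Rightarrow> nat" where
  "slot_param Q W G (b, v, s) = 2 * W * (b * Q + G b v) + (s * W + v)"

lemma slot_param_div_mod:
  assumes "v < W" "s < 2"
  shows "slot_param Q W G (b, v, s) div (2 * W) = b * Q + G b v"
    "slot_param Q W G (b, v, s) mod (2 * W) = s * W + v"
proof -
  have "s * W \<le> 1 * W" using assms(2) by (intro mult_le_mono1) simp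
  then have "s * W + v < 2 * W" using assms(1) by linarith
  then show "slot_param Q W G (b, v, s) div (2 * W) = b * Q + G b v"
    "slot_param Q W G (b, v, s) mod (2 * W) = s * W + v"
    by simp_all
qed

lemma mult_add_less_inject:
  fixes Q :: nat
  assumes "b * Q + g = b' * Q + g'" "g < Q" "g' < Q"
  shows "b = b' \<and> g = g'"
proof -
  have "(b * Q + g) div Q = b" using assms(2) by simp
  moreover have "(b' * Q + g') div Q = b'" using assms(3) by simp
  ultimately have "b = b'" using assms(1) by simp
  then show ?thesis using assms(1) by simp
qed

text \<open>The quotient by \<open>2 * W\<close> yields the block, since blocks own disjoint ranges
  of \<open>Q\<close> stripes. The remainder \<open>s * W + v\<close> yields pair and sign bit, so
  pairs sharing a stripe still give different points.\<close>

lemma inj_on_slot_param: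
  assumes "\<And>b v. b < N \<Longrightarrow> v < W \<Longrightarrow> G b v < Q"
  shows "inj_on (slot_param Q W G) (slots N W)"
proof (rule inj_onI)
  fix x y assume x: "x \<in> slots N W" and y: "y \<in> slots N W"
    and eq: "slot_param Q W G x = slot_param Q W G y"
  obtain b v s b' v' s' where xy: "x = (b, v, s)" "y = (b', v', s')" by (metis prod_cases3)
  have bounds: "b < N" "v < W" "s < 2" "b' < N" "v' < W" "s' < 2"
    using x y by (auto simp: slots_def xy)
  have "s * W + v = s' * W + v'" "b * Q + G b v = b' * Q + G b' v'"
    using slot_param_div_mod[OF bounds(2,3), of Q G b] slot_param_div_mod[OF bounds(5,6), of Q G b'] eq
    by (simp_all add: xy)
  then show "x = y"
    using mult_add_less_inject bounds assms unfolding xy by blast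
qed

lemma card_occupied_stripes:
  assumes "\<And>b v. b < N \<Longrightarrow> v < W \<Longrightarrow> G b v < Q"
  shows "card ((\<lambda>t. t div (2 * W)) ` slot_param Q W G ` slots N W) = (\<Sum>b<N. card (G b ` {..<W}))"
proof -
  have "(\<lambda>t. t div (2 * W)) ` slot_param Q W G ` slots N W =
      (\<lambda>x. slot_param Q W G x div (2 * W)) ` slots N W" by (rule image_image)
  also have "\<dots> = (\<lambda>(b, v, s). b * Q + G b v) ` slots N W"
    by (rule image_cong) (auto simp: slots_def slot_param_div_mod simp del: slot_param.simps)
  also have "\<dots> = (\<lambda>(b, g). b * Q + g) ` (SIGMA b:{..<N}. G b ` {..<W})"
  proof -
    have "(\<lambda>(b, v, s). (b, G b v)) ` slots N W = (SIGMA b:{..<N}. G b ` {..<W})"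
    proof (intro equalityI subsetI)
      fix x assume "x \<in> (SIGMA b:{..<N}. G b ` {..<W})"
      then obtain b v where "x = (b, G b v)" "b < N" "v < W" by auto
      then show "x \<in> (\<lambda>(b, v, s). (b, G b v)) ` slots N W"
        by (intro image_eqI[of _ _ "(b, v, 0)"]) (auto simp: slots_def)
    qed (auto simp: slots_def)
    then have "(\<lambda>(b, g). b * Q + g) ` (SIGMA b:{..<N}. G b ` {..<W}) =
        (\<lambda>(b, g). b * Q + g) ` (\<lambda>(b, v, s). (b, G b v)) ` slots N W" by simp
    then show ?thesis by (simp add: image_image case_prod_unfold)
  qed
  also have "card \<dots> = card (SIGMA b:{..<N}. G b ` {..<W})"
  proof (rule card_image, rule inj_onI)
    fix x y :: "nat \<times> nat"
    assume "x \<in> (SIGMA b:{..<N}. G b ` {..<W})" "y \<in> (SIGMA b:{..<N}. G b ` {..<W})"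
      "(case x of (b, g) \<Rightarrow> b * Q + g) = (case y of (b, g) \<Rightarrow> b * Q + g)"
    then show "x = y"
      using mult_add_less_inject[of "fst x" Q "snd x" "fst y" "snd y"] assms
      by (auto simp: prod_eq_iff split: prod.splits)
  qed
  finally show ?thesis by simp
qed

section \<open>Block inputs and what a sample reveals of them\<close>

definition block_inputs :: "nat \<Rightarrow> nat pmf \<Rightarrow> nat \<Rightarrow> nat set \<Rightarrow> (nat \<Rightarrow> nat \<Rightarrow> nat) pmf" where
  "block_inputs N p Q S = Pi_pmf {..<N} (\<lambda>_. 0) (\<lambda>_. bind_pmf p (slot_law Q S))"

definition slot_sample :: "nat \<Rightarrow> nat \<Rightarrow> nat \<Rightarrow> (nat \<Rightarrow> nat \<Rightarrow> nat) \<Rightarrow> nat \<times> nat \<times> nat \<Rightarrow> point \<times> int" where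
  "slot_sample n Q W G x = (let y = curve n (slot_param Q W G x) in (y, stripe_label W y))"

abbreviation slot_points :: "nat \<Rightarrow> nat \<Rightarrow> nat \<Rightarrow> nat \<Rightarrow> (nat \<Rightarrow> nat \<Rightarrow> nat) \<Rightarrow> point set" where
  "slot_points n Q W N G \<equiv> curve n ` slot_param Q W G ` slots N W"

lemma finite_slots: "finite (slots N W)"
  by (simp add: slots_def)

lemma slots_nonempty:
  assumes "N > 0" "W > 0"
  shows "slots N W \<noteq> {}"
proof -
  have "(0, 0, 0) \<in> slots N W" using assms by (simp add: slots_def)
  then show ?thesis by blast
qed

lemma card_slots: "card (slots N W) = 2 * N * W"
  by (simp add: slots_def card_cartesian_product)

text \<open>Slots correspond bijectively to points, so sampling the set amounts to sampling slots
  uniformly. The law of the slot list does not depend on \<open>G\<close>, which allows the slots to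
  be drawn first.\<close>

lemma tester_output_slot_points:
  assumes "n \<ge> 1" "N > 0" "W > 0" "\<And>b v. b < N \<Longrightarrow> v < W \<Longrightarrow> G b v < Q"
  shows "tester_output A m (slot_points n Q W N G) (stripe_label W) =
    bind_pmf (replicate_pmf m (pmf_of_set (slots N W))) (\<lambda>xs. A (map (slot_sample n Q W G) xs))"
proof -
  have "inj_on (curve n \<circ> slot_param Q W G) (slots N W)"
    using inj_on_slot_param[OF assms(4)] inj_curve[OF assms(1)]
    by (intro comp_inj_on) (auto intro: inj_on_subset)
  then have "pmf_of_set (slot_points n Q W N G) = map_pmf (curve n \<circ> slot_param Q W G) (pmf_of_set (slots N W))"
    using map_pmf_of_set_inj[of "curve n \<circ> slot_param Q W G" "slots N W"] slots_nonempty[OF assms(2,3)]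
    by (simp add: finite_slots image_comp)
  moreover have "slot_sample n Q W G =
      (\<lambda>x. (curve n (slot_param Q W G x), stripe_label W (curve n (slot_param Q W G x))))"
    by (simp add: fun_eq_iff slot_sample_def Let_def)
  ultimately show ?thesis
    by (simp add: tester_output_def labelled_samples_def map_pmf_comp map_replicate_pmf bind_map_pmf)
qed

text \<open>The set \<open>R b\<close> of revealed coordinates differs from block to block. Blocks
  are independent and slot laws are consistent under restriction, so the visible part is again a
  product.\<close>

lemma restricted_block_inputs:
  assumes "\<And>b. b < N \<Longrightarrow> R b \<subseteq> T" "finite T"
  shows "map_pmf (\<lambda>G b. if b < N then restrict0 (R b) (G b) else (\<lambda>_. 0)) (block_inputs N p Q T) =
    Pi_pmf {..<N} (\<lambda>_. 0) (\<lambda>b. bind_pmf p (slot_law Q (R b)))"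
proof -
  have "Pi_pmf {..<N} (\<lambda>_. 0) (\<lambda>b. bind_pmf p (slot_law Q (R b))) =
      Pi_pmf {..<N} (\<lambda>_. 0) (\<lambda>b. map_pmf (restrict0 (R b)) (bind_pmf p (slot_law Q T)))"
    using assms by (intro Pi_pmf_cong) (auto simp: map_bind_pmf restrict_slot_law)
  then show ?thesis
    by (simp add: Pi_pmf_map_dependent[where d' = "\<lambda>_. 0"] block_inputs_def)
qed

lemma card_slots_of_block_le:
  "card {v. \<exists>s. (b, v, s) \<in> set xs} \<le> length (filter (\<lambda>x. fst x = b) xs)"
proof -
  have "{v. \<exists>s. (b, v, s) \<in> set xs} = (\<lambda>x. fst (snd x)) ` set (filter (\<lambda>x. fst x = b) xs)"
    by force
  then show ?thesis
    by (metis List.finite_set card_image_le card_length le_trans)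
qed

text \<open>For a fixed slot list the samples depend on \<open>G\<close> only through the pairs that
  were hit, at most K in each block. Every block draws its own u, so agreement within each block
  gives agreement of the products.\<close>

lemma block_inputs_indistinguishable:
  assumes "\<And>S. finite S \<Longrightarrow> card S \<le> K \<Longrightarrow> bind_pmf p (slot_law Q S) = bind_pmf p' (slot_law Q S)"
    and xs: "set xs \<subseteq> slots N W" "\<And>b. b < N \<Longrightarrow> length (filter (\<lambda>x. fst x = b) xs) \<le> K"
  shows "bind_pmf (block_inputs N p Q {..<W}) (\<lambda>G. A (map (slot_sample n Q W G) xs)) =
    bind_pmf (block_inputs N p' Q {..<W}) (\<lambda>G. A (map (slot_sample n Q W G) xs))"
proof -
  define R where "R b = {v. \<exists>s. (b, v, s) \<in> set xs}" for b
  \<comment> \<open>\<open>\<rho>\<close> erases every coordinate that the list does not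
    read.\<close>
  define \<rho> where "\<rho> G = (\<lambda>b. if b < N then restrict0 (R b) (G b) else (\<lambda>_. 0))"
    for G :: "nat \<Rightarrow> nat \<Rightarrow> nat"
  have R: "R b \<subseteq> {..<W}" for b using xs(1) by (auto simp: R_def slots_def)
  have card_R: "card (R b) \<le> K" if "b < N" for b
    using card_slots_of_block_le[of b xs] xs(2)[OF that] by (simp add: R_def)
  have param_eq: "slot_param Q W G x = slot_param Q W (\<rho> G) x" if "x \<in> set xs" for G x
  proof -
    obtain b v s where x: "x = (b, v, s)" by (metis prod_cases3)
    have "b < N" using that xs(1) by (auto simp: slots_def x)
    moreover have "v \<in> R b" using that by (auto simp: R_def x)
    ultimately show ?thesis by (simp add: x \<rho>_def)
  qed
  have map_eq: "map (slot_sample n Q W G) xs = map (slot_sample n Q W (\<rho> G)) xs" for G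
  proof (rule map_cong[OF refl])
    fix x assume "x \<in> set xs"
    show "slot_sample n Q W G x = slot_sample n Q W (\<rho> G) x"
      unfolding slot_sample_def by (subst (1) param_eq[OF \<open>x \<in> set xs\<close>, of G]) (rule refl)
  qed
  have "bind_pmf (block_inputs N r Q {..<W}) (\<lambda>G. A (map (slot_sample n Q W G) xs)) =
      bind_pmf (map_pmf \<rho> (block_inputs N r Q {..<W})) (\<lambda>G. A (map (slot_sample n Q W G) xs))" for r
    unfolding bind_map_pmf by (rule bind_pmf_cong[OF refl], rule arg_cong[where f = A], rule map_eq)
  moreover have "map_pmf \<rho> (block_inputs N p Q {..<W}) = map_pmf \<rho> (block_inputs N p' Q {..<W})"
  proof -
    have "Pi_pmf {..<N} (\<lambda>_. 0) (\<lambda>b. bind_pmf p (slot_law Q (R b))) =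
        Pi_pmf {..<N} (\<lambda>_. 0) (\<lambda>b. bind_pmf p' (slot_law Q (R b)))"
      using assms(1)[OF finite_subset[OF R] card_R] by (intro Pi_pmf_cong) auto
    then show ?thesis
      unfolding \<rho>_def using R by (simp add: restricted_block_inputs)
  qed
  ultimately show ?thesis by simp
qed

text \<open>Union bound over the blocks; a uniform slot falls into a given block with probability
  1/N.\<close>

lemma crowded_block_probability:
  assumes "N > 0" "W > 0"
  shows "measure (replicate_pmf m (pmf_of_set (slots N W)))
      {xs. \<exists>b<N. Suc K \<le> length (filter (\<lambda>x. fst x = b) xs)} \<le> real N * (real m / real N) ^ Suc K"
proof -
  let ?R = "replicate_pmf m (pmf_of_set (slots N W))"
  have "measure ?R (\<Union>b\<in>{..<N}. {xs. Suc K \<le> length (filter (\<lambda>x. fst x = b) xs)})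
      \<le> (\<Sum>b<N. measure ?R {xs. Suc K \<le> length (filter (\<lambda>x. fst x = b) xs)})"
    by (intro measure_pmf.finite_measure_subadditive_finite) auto
  also have "\<dots> \<le> (\<Sum>b<N. (real m / real N) ^ Suc K)"
  proof (rule sum_mono)
    fix b assume "b \<in> {..<N}"
    then have "slots N W \<inter> {x. fst x = b} = {b} \<times> {..<W} \<times> {..<2}" by (auto simp: slots_def)
    then have "measure (pmf_of_set (slots N W)) {x. fst x = b} = 1 / real N"
      using assms slots_nonempty[OF assms]
      by (simp add: measure_pmf_of_set finite_slots card_slots card_cartesian_product)
    then show "measure ?R {xs. Suc K \<le> length (filter (\<lambda>x. fst x = b) xs)} \<le> (real m / real N) ^ Suc K"
      using replicate_pmf_count_tail[of m "pmf_of_set (slots N W)" "Suc K" "\<lambda>x. fst x = b"] by simp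
  qed
  also have "(\<Union>b\<in>{..<N}. {xs. Suc K \<le> length (filter (\<lambda>x. fst x = b) xs)}) =
      {xs. \<exists>b<N. Suc K \<le> length (filter (\<lambda>x. fst x = b) xs)}" by auto
  finally show ?thesis by simp
qed

section \<open>Support and occupancy of the slot laws\<close>

lemma slot_law_bounds:
  assumes "g \<in> set_pmf (slot_law Q S u)" "finite S" "Q > 0"
  shows "g v < Q" "u > 0 \<Longrightarrow> card (g ` S) \<le> u"
proof -
  have U: "set_pmf (pmf_of_set {..<k}) = {..<k}" if "k > 0" for k :: nat
    using that by (subst set_pmf_of_set) auto
  have "g v < Q \<and> (u > 0 \<longrightarrow> card (g ` S) \<le> u)"
  proof (cases "u = 0")
    case True
    then show ?thesis
      using assms U by (cases "v \<in> S") (auto simp: slot_law_def set_Pi_pmf PiE_dflt_def)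
  next
    case False
    then obtain L where L: "L \<in> set_pmf (Pi_pmf {..<u} 0 (\<lambda>_. pmf_of_set {..<Q}))"
      and g: "g \<in> set_pmf (Pi_pmf S 0 (\<lambda>_. map_pmf L (pmf_of_set {..<u})))"
      using assms(1) by (auto simp: slot_law_def)
    have L': "L i < Q" if "i < u" for i
      using L that assms U by (auto simp: set_Pi_pmf PiE_dflt_def)
    have g': "g w \<in> L ` {..<u}" if "w \<in> S" for w
      using g that assms U[of u] False by (auto simp: set_Pi_pmf PiE_dflt_def)
    have g0: "g w = 0" if "w \<notin> S" for w
      using g that assms by (auto simp: set_Pi_pmf PiE_dflt_def)
    have "g v < Q"
      using g'[of v] g0[of v] L' assms(3) by (cases "v \<in> S") auto
    moreover have "card (g ` S) \<le> card (L ` {..<u})"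
      using g' by (intro card_mono) auto
    moreover have "card (L ` {..<u}) \<le> u"
      using card_image_le[of "{..<u}" L] by simp
    ultimately show ?thesis by linarith
  qed
  then show "g v < Q" "u > 0 \<Longrightarrow> card (g ` S) \<le> u" by auto
qed

lemma finite_set_slot_law:
  assumes "finite S" "Q > 0"
  shows "finite (set_pmf (slot_law Q S u))"
proof -
  have U: "finite (set_pmf (pmf_of_set {..<k}))" if "k > 0" for k :: nat
    using that by (subst set_pmf_of_set) auto
  show ?thesis
    using assms U by (auto simp: slot_law_def intro!: finite_set_Pi_pmf)
qed

text \<open>Only the atom u = 0 is counted. There \<open>32 * W\<close> stripes cost at most W/32 in
  collisions, and 15/16 times 31/32 is 465/512.\<close>

lemma expected_occupied_locations:
  assumes "finite (set_pmf p)" "pmf p 0 \<ge> 15 / 16" "W > 0"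
  shows "measure_pmf.expectation (bind_pmf p (slot_law (32 * W) {..<W})) (\<lambda>g. real (card (g ` {..<W})))
    \<ge> 465 / 512 * real W"
proof -
  let ?E = "\<lambda>u. measure_pmf.expectation (slot_law (32 * W) {..<W} u) (\<lambda>g. real (card (g ` {..<W})))"
  have fin: "finite (set_pmf (slot_law (32 * W) {..<W} u))" for u
    using assms(3) by (intro finite_set_slot_law) auto
  have E0: "?E 0 \<ge> 31 / 32 * real W"
    using expected_card_image_Pi_pmf[of "{..<W}" "32 * W"] assms(3)
    by (simp add: slot_law_def power2_eq_square)
  have "465 / 512 * real W = 15 / 16 * (31 / 32 * real W)" by simp
  also have "\<dots> \<le> pmf p 0 * ?E 0"
    using assms(2) E0 by (intro mult_mono) auto
  also have "\<dots> = (\<Sum>u\<in>{0}. pmf p u * ?E u)" by simp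
  also have "\<dots> \<le> (\<Sum>u\<in>insert 0 (set_pmf p). pmf p u * ?E u)"
    using assms(1) by (intro sum_mono2) (auto intro!: mult_nonneg_nonneg Bochner_Integration.integral_nonneg)
  also have "\<dots> = measure_pmf.expectation p ?E"
    using assms(1) by (subst integral_measure_pmf[of "insert 0 (set_pmf p)"]) auto
  also have "\<dots> = measure_pmf.expectation (bind_pmf p (slot_law (32 * W) {..<W})) (\<lambda>g. real (card (g ` {..<W})))"
    using assms(1) fin by (simp add: expectation_bind_finite)
  finally show ?thesis .
qed

section \<open>The sample lower bound\<close>

lemma set_block_inputs:
  assumes "G \<in> set_pmf (block_inputs N p Q S)" "b < N"
  shows "\<exists>u\<in>set_pmf p. G b \<in> set_pmf (slot_law Q S u)"
  using assms by (auto simp: block_inputs_def set_Pi_pmf PiE_dflt_def)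

lemma block_inputs_less:
  assumes "G \<in> set_pmf (block_inputs N p Q S)" "finite S" "Q > 0" "b < N"
  shows "G b v < Q"
  using set_block_inputs[OF assms(1,4)] slot_law_bounds(1)[OF _ assms(2,3)] by blast

lemma realizable_block_inputs:
  assumes "G \<in> set_pmf (block_inputs N p Q {..<W})" "set_pmf p \<subseteq> {1..U}"
    and "n \<ge> 1" "W > 0" "Q > 0" "2 * (N * U) \<le> n"
  shows "realizable n (slot_points n Q W N G) (stripe_label W)"
proof (rule realizable_few_stripes)
  have "card (G b ` {..<W}) \<le> U" if b: "b < N" for b
  proof -
    obtain u where u: "u \<in> set_pmf p" "G b \<in> set_pmf (slot_law Q {..<W} u)"
      using set_block_inputs[OF assms(1) b] by blast
    then have "u > 0" "u \<le> U" using assms(2) by auto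
    then show ?thesis using slot_law_bounds(2)[OF u(2)] assms(5) by force
  qed
  then have "(\<Sum>b<N. card (G b ` {..<W})) \<le> (\<Sum>b<N. U)" by (intro sum_mono) auto
  then show "2 * card ((\<lambda>t. t div (2 * W)) ` slot_param Q W G ` slots N W) \<le> n"
    using assms(5,6) block_inputs_less[OF assms(1)] by (simp add: card_occupied_stripes)
qed (use assms in \<open>auto simp: finite_slots\<close>)

text \<open>The two points of a pair lie in different halves of the same stripe, so every occupied
  stripe counts. At least N W/2 - n >= N W/4 labels must change, an eighth of at most 2 N W
  points.\<close>

lemma far_many_locations:
  assumes "\<And>b v. b < N \<Longrightarrow> v < W \<Longrightarrow> G b v < Q" "n \<ge> 1" "W > 0" "4 * n \<le> N * W"
    and "N * W \<le> 2 * (\<Sum>b<N. card (G b ` {..<W}))" "\<epsilon> \<le> 1 / 8"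
  shows "far_from_realizable n \<epsilon> (slot_points n Q W N G) (stripe_label W)"
  unfolding far_from_realizable_def
proof (intro allI impI, elim conjE)
  fix l' assume "realizable n (slot_points n Q W N G) l'"
  let ?T = "slot_param Q W G ` slots N W" and ?M = "(\<lambda>t. t div (2 * W)) ` slot_param Q W G ` slots N W"
  let ?m = "card {x \<in> slot_points n Q W N G. l' x \<noteq> stripe_label W x}"
  have "\<exists>t\<in>?T. t div (2 * W) = k \<and> t mod (2 * W) < W"
    "\<exists>t\<in>?T. t div (2 * W) = k \<and> \<not> t mod (2 * W) < W" if k: "k \<in> ?M" for k
  proof -
    obtain b v s where x: "(b, v, s) \<in> slots N W" "k = slot_param Q W G (b, v, s) div (2 * W)"
      using k by auto
    then have bv: "v < W" "s < 2" "(b, v, 0) \<in> slots N W" "(b, v, 1) \<in> slots N W"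
      by (auto simp: slots_def)
    show "\<exists>t\<in>?T. t div (2 * W) = k \<and> t mod (2 * W) < W"
      using bv x(2) by (intro bexI[of _ "slot_param Q W G (b, v, 0)"])
        (auto simp: slot_param_div_mod simp del: slot_param.simps)
    show "\<exists>t\<in>?T. t div (2 * W) = k \<and> \<not> t mod (2 * W) < W"
      using bv x(2) by (intro bexI[of _ "slot_param Q W G (b, v, 1)"])
        (auto simp: slot_param_div_mod simp del: slot_param.simps)
  qed
  from modified_many_stripes[OF assms(2,3) _ \<open>realizable _ _ _\<close> this]
  have "card ?M \<le> ?m + n" by (simp add: finite_slots)
  then have "(\<Sum>b<N. card (G b ` {..<W})) \<le> ?m + n"
    using assms(1) by (simp add: card_occupied_stripes)
  then have m: "N * W \<le> 4 * ?m" using assms(4,5) by linarith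
  have "card (slot_points n Q W N G) \<le> card (slots N W)"
    unfolding image_image by (rule card_image_le[OF finite_slots])
  then have card: "card (slot_points n Q W N G) \<le> 2 * (N * W)" by (simp add: card_slots)
  have "\<epsilon> * real (card (slot_points n Q W N G)) \<le> 1 / 8 * real (card (slot_points n Q W N G))"
    using assms(6) by (intro mult_right_mono) auto
  also have "\<dots> \<le> real ?m"
  proof -
    have "card (slot_points n Q W N G) \<le> 8 * ?m" using m card by linarith
    then have "real (card (slot_points n Q W N G)) \<le> real (8 * ?m)" by (rule of_nat_mono)
    then show ?thesis by simp
  qed
  finally show "\<epsilon> * real (card (slot_points n Q W N G)) \<le> real ?m" .
qed

section \<open>Comparing the two instance laws\<close>

lemma expected_locations_block_inputs:
  assumes "finite (set_pmf p)" "pmf p 0 \<ge> 15 / 16" "W > 0"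
  shows "measure_pmf.expectation (block_inputs N p (32 * W) {..<W}) (\<lambda>G. \<Sum>b<N. real (card (G b ` {..<W})))
    \<ge> 465 / 512 * (real N * real W)"
proof -
  let ?L = "bind_pmf p (slot_law (32 * W) {..<W})" and ?P = "block_inputs N p (32 * W) {..<W}"
  have finL: "finite (set_pmf ?L)" using assms by (auto intro!: finite_set_slot_law)
  then have fin: "finite (set_pmf ?P)" unfolding block_inputs_def by (intro finite_set_Pi_pmf) auto
  have "measure_pmf.expectation ?P (\<lambda>G. \<Sum>b<N. real (card (G b ` {..<W}))) =
      (\<Sum>b<N. measure_pmf.expectation ?P (\<lambda>G. real (card (G b ` {..<W}))))"
    using fin by (simp add: integrable_measure_pmf_finite)
  also have "\<dots> = (\<Sum>b<N. measure_pmf.expectation ?L (\<lambda>g. real (card (g ` {..<W}))))"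
  proof (rule sum.cong[OF refl])
    fix b assume "b \<in> {..<N}"
    then have "?L = map_pmf (\<lambda>G. G b) ?P"
      by (simp add: block_inputs_def Pi_pmf_component)
    then show "measure_pmf.expectation ?P (\<lambda>G. real (card (G b ` {..<W}))) =
        measure_pmf.expectation ?L (\<lambda>g. real (card (g ` {..<W})))"
      by (simp only: integral_map_pmf)
  qed
  also have "\<dots> \<ge> (\<Sum>b<N. 465 / 512 * real W)"
    using expected_occupied_locations[OF assms] by (intro sum_mono) auto
  finally show ?thesis by simp
qed

text \<open>Draw the slots first. On a list that hits no block more than K times the two acceptance
  probabilities agree; on the others they differ by at most 1.\<close>

lemma indistinguishable_up_to_crowding:
  fixes m :: nat
  assumes "\<And>S. finite S \<Longrightarrow> card S \<le> K \<Longrightarrow> bind_pmf p (slot_law Q S) = bind_pmf p' (slot_law Q S)"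
    and "N > 0" "W > 0"
  defines "R \<equiv> replicate_pmf m (pmf_of_set (slots N W))"
  shows "pmf (bind_pmf (block_inputs N p Q {..<W}) (\<lambda>G. bind_pmf R (\<lambda>xs. A (map (slot_sample n Q W G) xs)))) True
    \<le> pmf (bind_pmf (block_inputs N p' Q {..<W}) (\<lambda>G. bind_pmf R (\<lambda>xs. A (map (slot_sample n Q W G) xs)))) True
      + real N * (real m / real N) ^ Suc K"
proof -
  define a where "a r xs = pmf (bind_pmf (block_inputs N r Q {..<W}) (\<lambda>G. A (map (slot_sample n Q W G) xs))) True"
    for r xs
  have swap: "pmf (bind_pmf (block_inputs N r Q {..<W}) (\<lambda>G. bind_pmf R (\<lambda>xs. A (map (slot_sample n Q W G) xs)))) True
      = measure_pmf.expectation R (a r)" for r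
    by (subst bind_commute_pmf) (simp only: pmf_bind[of R] a_def[abs_def])
  define B where "B = {xs :: (nat \<times> nat \<times> nat) list. \<exists>b<N. Suc K \<le> length (filter (\<lambda>x. fst x = b) xs)}"
  have int: "integrable R (a r)" for r
    by (rule measure_pmf.integrable_const_bound[where B = 1]) (auto simp: a_def pmf_le_1)
  have intB: "integrable R (indicator B :: _ \<Rightarrow> real)"
    by (rule measure_pmf.integrable_const_bound[where B = 1]) auto
  have "a p xs \<le> a p' xs + indicator B xs" if xs: "xs \<in> set_pmf R" for xs
  proof (cases "xs \<in> B")
    case True
    then show ?thesis by (simp add: a_def pmf_le_1 add_increasing)
  next
    case False
    have "set xs \<subseteq> slots N W"
      using xs slots_nonempty[OF assms(2,3)] by (auto simp: R_def set_replicate_pmf finite_slots)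
    moreover have "length (filter (\<lambda>x. fst x = b) xs) \<le> K" if "b < N" for b
      using False that by (auto simp: B_def not_less_eq_eq)
    ultimately have "a p xs = a p' xs"
      unfolding a_def by (subst block_inputs_indistinguishable[OF assms(1)]) auto
    then show ?thesis by simp
  qed
  then have "measure_pmf.expectation R (a p) \<le> measure_pmf.expectation R (\<lambda>xs. a p' xs + indicator B xs)"
    using int intB by (intro integral_mono_AE) (auto simp: AE_measure_pmf_iff)
  also have "\<dots> = measure_pmf.expectation R (a p') + measure R B"
    using int intB by simp
  finally show ?thesis
    unfolding swap using crowded_block_probability[OF assms(2,3), of m K] by (simp add: R_def B_def)
qed

lemma tester_crowding_bound:
  assumes tester: "halfspace_tester n \<epsilon> m A" and "\<epsilon> \<le> 1 / 8"
    and N: "N > 0" "2 * (N * 64 ^ K) \<le> n" "n \<le> 4 * (N * 64 ^ K)"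
  shows "1 / 8 \<le> real N * (real m / real N) ^ Suc K"
proof -
  obtain p p' where p: "set_pmf p \<subseteq> {1..64 ^ K}" "finite (set_pmf p')" "pmf p' 0 \<ge> 15 / 16"
    and eq: "\<And>Q S. Q > 0 \<Longrightarrow> finite S \<Longrightarrow> card S \<le> K \<Longrightarrow> bind_pmf p (slot_law Q S) = bind_pmf p' (slot_law Q S)"
    using indistinguishable_slot_laws[of K] by blast
  \<comment> \<open>Since n <= 4 N 64^K, the factor 16 ensures N W >= 4 n; the factor 32 in
    \<open>Q\<close> keeps collisions rare.\<close>
  define W where "W = (16 * 64 ^ K :: nat)"
  define Q where "Q = 32 * W"
  have W: "W > 0" "Q > 0" by (simp_all add: W_def Q_def)
  have "N * 64 ^ K > 0" using N(1) by simp
  then have n: "n \<ge> 1" using N(2) by linarith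
  define R where "R = replicate_pmf m (pmf_of_set (slots N W))"
  define out where "out G = bind_pmf R (\<lambda>xs. A (map (slot_sample n Q W G) xs))" for G
  have out: "tester_output A m (slot_points n Q W N G) (stripe_label W) = out G"
    if "\<And>b v. b < N \<Longrightarrow> v < W \<Longrightarrow> G b v < Q" for G
    unfolding out_def R_def using tester_output_slot_points[OF n N(1) W(1) that] by simp
  have labelled: "labelled_set n (slot_points n Q W N G) (stripe_label W)" for G
    using slots_nonempty[OF N(1) W(1)] by (intro labelled_set_curve) (simp_all add: finite_slots)
  have less: "G b v < Q" if "G \<in> set_pmf (block_inputs N r Q {..<W})" "b < N" for G b v r
    using block_inputs_less[OF that(1) _ W(2) that(2)] by simp
  have yes: "pmf (bind_pmf (block_inputs N p Q {..<W}) out) True \<ge> 2 / 3"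
  proof -
    have "pmf (out G) True \<ge> 2 / 3" if G: "G \<in> set_pmf (block_inputs N p Q {..<W})" for G
      using tester labelled realizable_block_inputs[OF G p(1) n W N(2)] out less[OF G]
      by (metis halfspace_tester_def)
    then have "measure_pmf.expectation (block_inputs N p Q {..<W}) (\<lambda>_. 2 / 3) \<le>
        measure_pmf.expectation (block_inputs N p Q {..<W}) (\<lambda>G. pmf (out G) True)"
      by (intro integral_mono_AE)
         (auto simp: AE_measure_pmf_iff pmf_le_1 intro: measure_pmf.integrable_const_bound[where B = 1])
    then show ?thesis by (simp add: pmf_bind)
  qed
  \<comment> \<open>An instance drawn from \<open>p'\<close> is far once it occupies at least c/2
    stripes, where c = N W. The number of occupied stripes has mean at least 465/512 c, so the
    remaining instances add at most 2 - 930/512 = 47/256.\<close>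
  have no: "pmf (bind_pmf (block_inputs N p' Q {..<W}) out) True \<le> 1 / 3 + 47 / 256"
  proof -
    let ?P = "block_inputs N p' Q {..<W}"
    define D where "D G = (\<Sum>b<N. real (card (G b ` {..<W})))" for G :: "nat \<Rightarrow> nat \<Rightarrow> nat"
    define c where "c = real N * real W"
    have c: "c > 0" using N W by (simp add: c_def)
    have D_le: "D G \<le> c" for G
    proof -
      have "D G \<le> (\<Sum>b<N. real W)"
        unfolding D_def using card_image_le[of "{..<W}"] by (intro sum_mono) simp
      then show ?thesis by (simp add: c_def)
    qed
    text \<open>Markov's inequality in pointwise form.\<close>
    have bound: "pmf (out G) True \<le> 1 / 3 + (2 - 2 / c * D G)" if G: "G \<in> set_pmf ?P" for G
    proof (cases "c \<le> 2 * D G")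
      case True
      have "far_from_realizable n \<epsilon> (slot_points n Q W N G) (stripe_label W)"
      proof (rule far_many_locations)
        have "real (N * W) \<le> real (2 * (\<Sum>b<N. card (G b ` {..<W})))"
          using True by (simp add: c_def D_def)
        then show "N * W \<le> 2 * (\<Sum>b<N. card (G b ` {..<W}))" by (simp only: of_nat_le_iff)
        show "4 * n \<le> N * W" using N(3) by (simp add: W_def)
      qed (use n W assms(2) less[OF G] in auto)
      then have "pmf (out G) False \<ge> 2 / 3"
        using tester labelled out less[OF G] by (metis halfspace_tester_def)
      moreover have "2 / c * D G \<le> 2" using D_le[of G] c by (simp add: field_simps)
      ultimately show ?thesis using pmf_False_conv_True[of "out G"] by linarith
    next
      case False
      then have "2 / c * D G \<le> 1" using c by (simp add: field_simps)
      then show ?thesis using pmf_le_1[of "out G" True] by linarith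
    qed
    have fin: "finite (set_pmf ?P)"
      unfolding block_inputs_def using p(2) W by (intro finite_set_Pi_pmf) (auto intro!: finite_set_slot_law)
    note int = integrable_measure_pmf_finite[OF fin]
    have "pmf (bind_pmf ?P out) True \<le> measure_pmf.expectation ?P (\<lambda>G. 1 / 3 + (2 - 2 / c * D G))"
      unfolding pmf_bind using bound by (intro integral_mono_AE int) (auto simp: AE_measure_pmf_iff)
    also have "\<dots> = 1 / 3 + (2 - 2 / c * measure_pmf.expectation ?P D)"
      by (subst Bochner_Integration.integral_add[OF int int], subst Bochner_Integration.integral_diff[OF int int]) simp
    also have "\<dots> \<le> 1 / 3 + (2 - 2 / c * (465 / 512 * c))"
      using expected_locations_block_inputs[OF p(2,3) W(1), of N] c
      by (intro add_left_mono diff_left_mono mult_left_mono) (auto simp: D_def[abs_def] Q_def c_def)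
    also have "\<dots> = 1 / 3 + 47 / 256" using c by simp
    finally show ?thesis .
  qed
  have "pmf (bind_pmf (block_inputs N p Q {..<W}) out) True \<le>
      pmf (bind_pmf (block_inputs N p' Q {..<W}) out) True + real N * (real m / real N) ^ Suc K"
    using indistinguishable_up_to_crowding[OF eq[OF W(2)] N(1) W(1)] unfolding out_def R_def by blast
  \<comment> \<open>The gap is 2/3 - 1/3 - 47/256 = 115/768, which exceeds 1/8.\<close>
  then show ?thesis using yes no by linarith
qed

section \<open>From the crowding bound to the exponent\<close>

lemma tester_samples_pos:
  assumes tester: "halfspace_tester n \<epsilon> m A" and "\<epsilon> \<le> 1 / 8" "n \<ge> 1"
  shows "m \<ge> 1"
proof (rule ccontr)
  assume "\<not> m \<ge> 1"
  then have "m = 0" by simp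
  then have out: "tester_output A m X l = A []" for X l
    by (simp add: tester_output_def labelled_samples_def bind_return_pmf)
  \<comment> \<open>The zero polynomial gives label + everywhere, as \<open>pm_sign\<close> is 1 at
    0, and the parameter 0 has label +.\<close>
  have "realizable n (curve n ` {0}) (stripe_label 1)"
    using halfspace_of_poly[of 0 n] assms(3) by (force simp: realizable_def stripe_label_curve pm_sign_def)
  then have yes: "pmf (A []) True \<ge> 2 / 3"
    using tester labelled_set_curve[of "{0}" n 1] out by (auto simp: halfspace_tester_def)
  \<comment> \<open>Consecutive integers with W = 1 alternate in sign: 2 n stripes are met in both
    halves, so at least n of the 4 n labels must change.\<close>
  define T where "T = {..<4 * n}"
  have "far_from_realizable n \<epsilon> (curve n ` T) (stripe_label 1)"
    unfolding far_from_realizable_def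
  proof (intro allI impI, elim conjE)
    fix l' assume realizable: "realizable n (curve n ` T) l'"
    have "card {..<2 * n} \<le> card {x \<in> curve n ` T. l' x \<noteq> stripe_label 1 x} + n"
    proof (rule modified_many_stripes[OF assms(3) _ _ realizable])
      fix k assume "k \<in> {..<2 * n}"
      then show "\<exists>t\<in>T. t div (2 * 1) = k \<and> t mod (2 * 1) < 1"
        "\<exists>t\<in>T. t div (2 * 1) = k \<and> \<not> t mod (2 * 1) < 1"
        by (auto simp: T_def intro: bexI[of _ "2 * k"] bexI[of _ "2 * k + 1"])
    qed (auto simp: T_def)
    moreover have "card (curve n ` T) \<le> 4 * n"
      using card_image_le[of T "curve n"] by (simp add: T_def)
    ultimately have "real (card (curve n ` T)) \<le> 4 * real (card {x \<in> curve n ` T. l' x \<noteq> stripe_label 1 x})"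
      by simp
    moreover have "\<epsilon> * real (card (curve n ` T)) \<le> 1 / 8 * real (card (curve n ` T))"
      using assms(2) by (intro mult_right_mono) auto
    ultimately show "\<epsilon> * real (card (curve n ` T)) \<le> real (card {x \<in> curve n ` T. l' x \<noteq> stripe_label 1 x})"
      by linarith
  qed
  moreover have "labelled_set n (curve n ` T) (stripe_label 1)"
    using assms(3) by (intro labelled_set_curve) (auto simp: T_def lessThan_empty_iff)
  ultimately have "pmf (A []) False \<ge> 2 / 3"
    using tester out by (auto simp: halfspace_tester_def)
  then show False using yes pmf_False_conv_True[of "A []"] by linarith
qed

text \<open>If m < n^(1-\<eta>), then m^(K+1) is at most n^(K-1) for suitable K, while N^K is of
  order n^K; for large n this contradicts the crowding bound. The threshold is uniform in
  \<epsilon>.\<close>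

lemma eventually_tester_samples_ge:
  assumes "\<eta> > 0"
  shows "\<exists>n\<^sub>0. \<forall>n\<ge>n\<^sub>0. \<forall>\<epsilon> m A. \<epsilon> \<le> 1 / 8 \<and> halfspace_tester n \<epsilon> m A \<longrightarrow> real m \<ge> real n powr (1 - \<eta>)"
proof -
  obtain K :: nat where "2 / \<eta> < real K" using reals_Archimedean2 by blast
  \<comment> \<open>Hence (K + 1)(1 - \<eta>) <= K - 1, which leaves a whole power of n to beat the
    constants.\<close>
  then have K: "\<eta> * (real K + 1) \<ge> 2" using assms by (simp add: field_simps)
  define U :: nat where "U = 64 ^ K"
  have U: "U > 0" by (simp add: U_def)
  \<comment> \<open>The first term exceeds the bound on n reached at the end; the second makes the
    number of blocks positive.\<close>
  define n\<^sub>0 where "n\<^sub>0 = 8 * (4 * U) ^ K + 2 * U + 1"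
  have "real m \<ge> real n powr (1 - \<eta>)"
    if n: "n \<ge> n\<^sub>0" and "\<epsilon> \<le> 1 / 8" and tester: "halfspace_tester n \<epsilon> m A" for n \<epsilon> m A
  proof (rule ccontr)
    assume m: "\<not> real m \<ge> real n powr (1 - \<eta>)"
    define N where "N = n div (2 * U)"
    have n0: "n > 0" and n_U: "2 * U \<le> n" and n_large: "8 * (4 * U) ^ K < n" using n by (simp_all add: n\<^sub>0_def)
    have N: "N > 0" using n_U U by (simp add: N_def div_greater_zero_iff)
    have lower: "2 * (N * U) \<le> n" using times_div_less_eq_dividend[of "2 * U" n] by (simp add: N_def mult_ac)
    have "n < 2 * U * (N + 1)"
      using dividend_less_times_div[of "2 * U" n] U by (simp add: N_def algebra_simps)
    \<comment> \<open>Rounding down costs at most a factor of 2, since N + 1 <= 2 N.\<close>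
    also have "\<dots> \<le> 2 * U * (2 * N)" using N by (intro mult_le_mono2) simp
    finally have "n < 4 * (N * U)" by (simp add: mult_ac)
    then have upper: "n \<le> 4 * (N * U)" by simp
    have "(real n powr (1 - \<eta>)) ^ Suc K = real n powr (real (Suc K) * (1 - \<eta>))"
      using n0 by (subst powr_power) simp_all
    also have "\<dots> \<le> real n powr (real K - 1)"
      using K n0 by (intro powr_mono) (simp_all add: algebra_simps)
    also have "\<dots> = real n ^ K / real n"
      using n0 by (simp add: powr_diff powr_realpow)
    also have "\<dots> \<le> (4 * real U * real N) ^ K / real n"
    proof (intro divide_right_mono power_mono)
      have "real n \<le> real (4 * (N * U))" using upper by (rule of_nat_mono)
      then show "real n \<le> 4 * real U * real N" by (simp add: mult_ac)
    qed simp_all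
    finally have power: "(real n powr (1 - \<eta>)) ^ Suc K \<le> (4 * real U * real N) ^ K / real n" .
    have "1 / 8 \<le> real N * (real m / real N) ^ Suc K"
      using tester_crowding_bound[OF tester \<open>\<epsilon> \<le> 1 / 8\<close> N] lower upper by (simp add: U_def)
    also have "\<dots> \<le> real N * (real n powr (1 - \<eta>) / real N) ^ Suc K"
      using m N by (intro mult_left_mono power_mono divide_right_mono) auto
    also have "\<dots> = (real n powr (1 - \<eta>)) ^ Suc K / real N ^ K"
      using N by (simp add: power_divide)
    also have "\<dots> \<le> (4 * real U * real N) ^ K / real n / real N ^ K"
      using power by (intro divide_right_mono) simp_all
    also have "\<dots> = (4 * real U) ^ K / real n"
      using N by (simp add: power_mult_distrib)
    finally have "1 / 8 \<le> (4 * real U) ^ K / real n" .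
    then have "real n \<le> 8 * (4 * real U) ^ K" using n0 by (simp add: field_simps)
    also have "\<dots> = real (8 * (4 * U) ^ K)" by simp
    finally show False using n_large by linarith
  qed
  then show ?thesis by blast
qed

theorem theorem6p13:
  "\<exists>\<epsilon>\<^sub>0 :: real. \<epsilon>\<^sub>0 > 0 \<and>
     (\<forall>\<epsilon> :: real. 0 < \<epsilon> \<and> \<epsilon> < \<epsilon>\<^sub>0 \<longrightarrow>
        (\<exists>\<delta> :: nat \<Rightarrow> real. \<delta> \<longlonglongrightarrow> 0 \<and>
           (\<forall>(n :: nat) (m :: nat) (A :: algorithm). n \<ge> 1 \<and> halfspace_tester n \<epsilon> m A \<longrightarrow>
              real m \<ge> real n powr (1 - \<delta> n))))"
proof (intro exI[of _ "1 / 8"] conjI allI impI)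
  fix \<epsilon> :: real assume "0 < \<epsilon> \<and> \<epsilon> < 1 / 8"
  then have \<epsilon>: "\<epsilon> \<le> 1 / 8" by simp
  define testable where "testable n m \<longleftrightarrow> (\<exists>A. halfspace_tester n \<epsilon> m A)" for n m
  define f where "f n = (LEAST m. testable n m)" for n
  \<comment> \<open>The exponent must depend on n alone, so it is read off the least sample size of
    a tester: n^(1 - \<delta> n) is at most \<open>f n\<close>, with equality unless the maximum
    cuts off. At n = 1 the logarithm in the denominator vanishes, hence the case
    distinction.\<close>
  define \<delta> where "\<delta> n = (if n \<ge> 2 \<and> (\<exists>m. testable n m) then max 0 (1 - ln (real (f n)) / ln (real n)) else 0)" for n
  have f: "testable n (f n)" "f n \<le> m" if "testable n m" for n m
    using that unfolding f_def by (auto intro: LeastI Least_le)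
  have f_pos: "f n \<ge> 1" if "testable n m" "n \<ge> 1" for n m
    using f(1)[OF that(1)] tester_samples_pos[OF _ \<epsilon> that(2)] by (auto simp: testable_def)
  have "\<delta> \<longlonglongrightarrow> 0"
  proof (rule LIMSEQ_I)
    fix e :: real assume "e > 0"
    then obtain n\<^sub>0 where n0: "\<And>n m. n \<ge> n\<^sub>0 \<Longrightarrow> testable n m \<Longrightarrow> real m \<ge> real n powr (1 - e / 2)"
      using eventually_tester_samples_ge[of "e / 2"] \<epsilon> unfolding testable_def by (metis half_gt_zero)
    have "norm (\<delta> n - 0) < e" if n: "n \<ge> n\<^sub>0" for n
    proof (cases "n \<ge> 2 \<and> (\<exists>m. testable n m)")
      case True
      then obtain m where m: "testable n m" by blast
      have "real n powr (1 - e / 2) \<le> real (f n)" using n0[OF n f(1)[OF m]] .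
      then have "ln (real n powr (1 - e / 2)) \<le> ln (real (f n))"
        using True by (intro ln_mono) auto
      then have "(1 - e / 2) * ln (real n) \<le> ln (real (f n))" using True by (simp add: ln_powr)
      then have "1 - e / 2 \<le> ln (real (f n)) / ln (real n)" using True by (simp add: field_simps)
      then show ?thesis using True \<open>e > 0\<close> by (simp add: \<delta>_def)
    qed (use \<open>e > 0\<close> in \<open>auto simp: \<delta>_def\<close>)
    then show "\<exists>no. \<forall>n\<ge>no. norm (\<delta> n - 0) < e" by blast
  qed
  moreover have "real m \<ge> real n powr (1 - \<delta> n)" if "n \<ge> 1" "halfspace_tester n \<epsilon> m A" for n m A
  proof -
    have m: "testable n m" using that(2) by (auto simp: testable_def)
    \<comment> \<open>That at least one sample is needed keeps the logarithm of \<open>f n\<close>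
      meaningful and settles n = 1, where the claimed bound is 1.\<close>
    have pos: "f n \<ge> 1" "f n \<le> m" using f_pos[OF m that(1)] f(2)[OF m] by auto
    show ?thesis
    proof (cases "n = 1")
      case True
      then show ?thesis using pos by simp
    next
      case False
      with that(1) have n: "n \<ge> 2" by simp
      have "real n powr (1 - \<delta> n) \<le> real n powr (ln (real (f n)) / ln (real n))"
        using n m by (intro powr_mono) (auto simp: \<delta>_def)
      also have "\<dots> = real (f n)" using n pos by (simp add: powr_def)
      also have "\<dots> \<le> real m" using pos by simp
      finally show ?thesis .
    qed
  qed
  ultimately show "\<exists>\<delta> :: nat \<Rightarrow> real. \<delta> \<longlonglongrightarrow> 0 \<and>
      (\<forall>(n :: nat) (m :: nat) (A :: algorithm). n \<ge> 1 \<and> halfspace_tester n \<epsilon> m A \<longrightarrow>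
         real m \<ge> real n powr (1 - \<delta> n))"
    by blast
qed simp

end
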